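(* Let $\kappa$ be an algebraically closed field of characteristic zero, complete for a non-trivial non-Archimedean absolute value. Fix a positive integer $n$ and $\alpha_i,\beta_i\in\kappa$ ($i=1,\dots,n$) with $|\alpha_i|=1$ such that $L_i(z)=\alpha_iz+\beta_i$ is not the identity map for each $i$. For a meromorphic function $g$, let $g_1,\dots,g_m$ denote a fixed finite list of operators applied to $g$, each of the form $g\mapsto\Delta_{L_i}^jg$ for some $i\in\{1,\dots,n\}$ and positive integer $j$. Let $\Omega(X_0,\dots,X_m)=\sum_{i\in I}c_iX_0^{i_0}\cdots X_m^{i_m}$ be a non-zero polynomial with coefficients in $\mathcal{M}(\kappa)$. Let $f\in\mathcal{M}(\kappa)$ be non-constant with $$\Omega(f,f_1,\dots,f_m)=0$$ and admissible, i.e. $\sum_{i\in I}T(r,c_i)=o(T(r,f))$ as $r\to\infty$. If $a\in\mathcal{M}(\kappa)$ satisfies $T(r,a)=o(T(r,f))$ and $\Omega(a,a_1,\dots,a_m)\not\equiv0$, then $$m\!\left(r,\frac1{f-a}\right)=o(T(r,f))\quad(r\to\infty).$$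
   Context: $\mathcal{M}(\kappa)$ is the field of meromorphic functions over $\kappa$ (quotients $g/h$ of power series converging on all of $\kappa$). For entire $g=\sum a_nz^n$, $\mu(r,g)=\max_n|a_n|r^n$; $\mu(r,g/h)=\mu(r,g)/\mu(r,h)$; $m(r,F)=\log^+\mu(r,F)$; $N(r,F)=\int_0^r\frac{n(t,F)-n(0,F)}{t}dt+n(0,F)\log r$ with $n(t,F)$ the number of poles in $|z|\le t$ counted with multiplicity; $T(r,F)=m(r,F)+N(r,F)$. $\Delta_Lg=g\circ L-g$, $\Delta_L^jg=\Delta_L(\Delta_L^{j-1}g)$. *)

theory Defs
  imports "HOL-Analysis.Analysis"
    "HOL-Computational_Algebra.Computational_Algebra"
    "HOL-Library.Landau_Symbols"
begin

definition nonarch_abs :: "('a::field \<Rightarrow> real) \<Rightarrow> bool" where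
  "nonarch_abs absv \<longleftrightarrow>
     (\<forall>x. absv x \<ge> 0) \<and> (\<forall>x. absv x = 0 \<longleftrightarrow> x = 0) \<and>
     (\<forall>x y. absv (x * y) = absv x * absv y) \<and>
     (\<forall>x y. absv (x + y) \<le> max (absv x) (absv y))"

definition nontrivial_abs :: "('a::field \<Rightarrow> real) \<Rightarrow> bool" where
  "nontrivial_abs absv \<longleftrightarrow> (\<exists>x. absv x \<noteq> 0 \<and> absv x \<noteq> 1)"

definition abs_complete :: "('a::field \<Rightarrow> real) \<Rightarrow> bool" where
  "abs_complete absv \<longleftrightarrow>
     (\<forall>X::nat \<Rightarrow> 'a. (\<forall>e>0. \<exists>N. \<forall>m\<ge>N. \<forall>n\<ge>N. absv (X m - X n) < e)
        \<longrightarrow> (\<exists>L. (\<lambda>n. absv (X n - L)) \<longlonglongrightarrow> 0))"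

definition alg_closed :: "'a::field itself \<Rightarrow> bool" where
  "alg_closed _ \<longleftrightarrow> (\<forall>p::'a poly. degree p > 0 \<longrightarrow> (\<exists>x. poly p x = 0))"

definition abs_sums :: "('a::field \<Rightarrow> real) \<Rightarrow> (nat \<Rightarrow> 'a) \<Rightarrow> 'a \<Rightarrow> bool" where
  "abs_sums absv u s \<longleftrightarrow> (\<lambda>N. absv (s - (\<Sum>n<N. u n))) \<longlonglongrightarrow> 0"

definition entire :: "('a::field \<Rightarrow> real) \<Rightarrow> 'a fps \<Rightarrow> bool" where
  "entire absv G \<longleftrightarrow> (\<forall>z. \<exists>s. abs_sums absv (\<lambda>n. fps_nth G n * z ^ n) s)"

definition entire_eval :: "('a::field \<Rightarrow> real) \<Rightarrow> 'a fps \<Rightarrow> 'a \<Rightarrow> 'a" where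
  "entire_eval absv G z = (THE s. abs_sums absv (\<lambda>n. fps_nth G n * z ^ n) s)"

definition entire_comp :: "('a::field \<Rightarrow> real) \<Rightarrow> 'a \<Rightarrow> 'a \<Rightarrow> 'a fps \<Rightarrow> 'a fps" where
  "entire_comp absv \<alpha> \<beta> G = (THE H. entire absv H \<and>
      (\<forall>z. entire_eval absv H z = entire_eval absv G (\<alpha> * z + \<beta>)))"

text \<open>The field M(kappa) of meromorphic functions: quotients of entire functions,
  realised inside the field of formal Laurent series (expansion at 0).\<close>
definition mero :: "('a::field \<Rightarrow> real) \<Rightarrow> 'a fls set" where
  "mero absv = {fps_to_fls G / fps_to_fls H | G H.
                  entire absv G \<and> entire absv H \<and> H \<noteq> 0}"

definition mero_comp :: "('a::field \<Rightarrow> real) \<Rightarrow> 'a \<Rightarrow> 'a \<Rightarrow> 'a fls \<Rightarrow> 'a fls" where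
  "mero_comp absv \<alpha> \<beta> F = (THE R. \<exists>G H. entire absv G \<and> entire absv H \<and> H \<noteq> 0 \<and>
      F = fps_to_fls G / fps_to_fls H \<and>
      R = fps_to_fls (entire_comp absv \<alpha> \<beta> G) / fps_to_fls (entire_comp absv \<alpha> \<beta> H))"

definition mero_delta :: "('a::field \<Rightarrow> real) \<Rightarrow> 'a \<Rightarrow> 'a \<Rightarrow> 'a fls \<Rightarrow> 'a fls" where
  "mero_delta absv \<alpha> \<beta> F = mero_comp absv \<alpha> \<beta> F - F"

definition mu_entire :: "('a::field \<Rightarrow> real) \<Rightarrow> real \<Rightarrow> 'a fps \<Rightarrow> real" where
  "mu_entire absv r G = (SUP n. absv (fps_nth G n) * r ^ n)"

definition mu_mero :: "('a::field \<Rightarrow> real) \<Rightarrow> real \<Rightarrow> 'a fls \<Rightarrow> real" where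
  "mu_mero absv r F = (THE v. \<exists>G H. entire absv G \<and> entire absv H \<and> H \<noteq> 0 \<and>
      F = fps_to_fls G / fps_to_fls H \<and> v = mu_entire absv r G / mu_entire absv r H)"

definition log_plus :: "real \<Rightarrow> real" where
  "log_plus x = (if x \<le> 1 then 0 else ln x)"

definition prox :: "('a::field \<Rightarrow> real) \<Rightarrow> real \<Rightarrow> 'a fls \<Rightarrow> real" where
  "prox absv r F = log_plus (mu_mero absv r F)"

text \<open>Order of the pole of F at z0: minus the subdegree of the Laurent expansion
  of F(z + z0) at 0 (zero if F has no pole at z0).\<close>
definition pole_ord :: "('a::field \<Rightarrow> real) \<Rightarrow> 'a fls \<Rightarrow> 'a \<Rightarrow> nat" where
  "pole_ord absv F z0 = nat (- fls_subdegree (mero_comp absv 1 z0 F))"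

definition pole_count :: "('a::field \<Rightarrow> real) \<Rightarrow> real \<Rightarrow> 'a fls \<Rightarrow> nat" where
  "pole_count absv t F = (\<Sum>z \<in> {z. absv z \<le> t \<and> pole_ord absv F z > 0}. pole_ord absv F z)"

definition count_fn :: "('a::field \<Rightarrow> real) \<Rightarrow> real \<Rightarrow> 'a fls \<Rightarrow> real" where
  "count_fn absv r F =
     integral {0..r} (\<lambda>t. (real (pole_count absv t F) - real (pole_count absv 0 F)) / t)
     + real (pole_count absv 0 F) * ln r"

definition char_fn :: "('a::field \<Rightarrow> real) \<Rightarrow> real \<Rightarrow> 'a fls \<Rightarrow> real" where
  "char_fn absv r F = prox absv r F + count_fn absv r F"

definition eval_mpoly :: "nat \<Rightarrow> (nat \<Rightarrow> nat) set \<Rightarrow> ((nat \<Rightarrow> nat) \<Rightarrow> 'b::comm_ring_1)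
     \<Rightarrow> (nat \<Rightarrow> 'b) \<Rightarrow> 'b" where
  "eval_mpoly m I c X = (\<Sum>e\<in>I. c e * (\<Prod>k\<le>m. X k ^ e k))"

definition diff_tuple :: "('a::field \<Rightarrow> real) \<Rightarrow> (nat \<Rightarrow> 'a) \<Rightarrow> (nat \<Rightarrow> 'a)
     \<Rightarrow> (nat \<Rightarrow> nat) \<Rightarrow> (nat \<Rightarrow> nat) \<Rightarrow> 'a fls \<Rightarrow> nat \<Rightarrow> 'a fls" where
  "diff_tuple absv \<alpha> \<beta> idx jj g k =
     (if k = 0 then g else (mero_delta absv (\<alpha> (idx k)) (\<beta> (idx k)) ^^ jj k) g)"

end

theory Submission
  imports Defs
begin

text \<open>
  The Gauss norm is multiplicative and, for large \<open>r\<close>, invariant under \<open>z \<mapsto> \<alpha>z + \<beta>\<close> with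
  \<open>|\<alpha>| = 1\<close>; hence every difference operator does not increase it. Put \<open>h = f - a\<close> and
  \<open>P = \<Omega>(a, a\<^sub>1, \<dots>)\<close>. Expanding \<open>P = \<Omega>(a, \<dots>) - \<Omega>(a + h, \<dots>)\<close> shows that, wherever
  \<open>\<mu>(r, h) \<le> 1\<close>, the norm \<open>\<mu>(r, P)\<close> is at most \<open>\<mu>(r, h)\<close> times a factor controlled by the
  \<open>m(r, c\<^sub>i)\<close> and \<open>m(r, a)\<close>. It remains to bound \<open>\<mu>(r, P)\<close> from below. Numerators do not
  decrease in norm, so \<open>1 / \<mu>(r, P)\<close> is controlled by the growth of a denominator of \<open>P\<close>, which
  is a product of translates of denominators of the \<open>c\<^sub>i\<close> and of \<open>a\<close>. For a fraction reduced in
  the disc of radius \<open>r\<close> the logarithm of the norm of the denominator is exactly \<open>N(r, F)\<close>: an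
  entire function without zeros in a disc has constant Gauss norm there (its truncations would
  otherwise have roots converging to a zero), and the linear factors account for the integral.
  The same reduced fractions show that \<open>T(r, f)\<close> tends to infinity for non-constant \<open>f\<close>.
\<close>

text \<open>The lower bound for \<open>P\<close> compares two radii. The radius \<open>s\<close> is
  fixed beyond every |beta_i|, so each substitution preserves Gauss norms both at \<open>s\<close>
  and at the varying radius \<open>r\<close>. Then \<open>P\<close> has a fixed positive norm p at
  \<open>s\<close>, and passing to \<open>r\<close> loses at most the growth of one denominator of
  \<open>P\<close> between the two radii. Where h has norm above 1 the proximity function is 0.
  Elsewhere the outcome is m(r, 1/(f - a)) <= 2 sum T(r, c_i) + K T(r, a) + |ln p|. The 2 arises
  because each coefficient enters once through its size and once through its denominator; K collects
  the degrees of the monomials and the doubling of denominators under each difference. The additive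
  constant is the reason for proving that T(r, f) tends to infinity. The obstacle is that a
  translated denominator loses its normalisation at 0, and that T(r, F) controls only a fraction
  adapted to the disc of radius r. Growth between two radii survives both.\<close>

locale nonarch_field =
  fixes v :: "'a::field \<Rightarrow> real"
  assumes nonarch: "nonarch_abs v"
    and nontrivial: "nontrivial_abs v"
    and complete: "abs_complete v"
    and closed: "alg_closed TYPE('a)"
begin

section \<open>Ultrametric absolute values\<close>

lemma v_nonneg [simp]: "0 \<le> v x"
  and v_eq_0 [simp]: "v x = 0 \<longleftrightarrow> x = 0"
  and v_mult [simp]: "v (x * y) = v x * v y"
  and v_add: "v (x + y) \<le> max (v x) (v y)"
  using nonarch unfolding nonarch_abs_def by blast+

lemma v_zero [simp]: "v 0 = 0" by simp

lemma v_pos: "x \<noteq> 0 \<Longrightarrow> 0 < v x"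
  using v_nonneg[of x] v_eq_0[of x] by linarith

lemma v_one [simp]: "v 1 = 1"
  using v_mult[of 1 1] v_eq_0[of 1] by (simp del: v_mult v_eq_0)

lemma v_uminus [simp]: "v (- x) = v x"
proof -
  have "v (-1) * v (-1) = 1" using v_mult[of "-1" "-1"] by simp
  then have "v (-1) = 1" using v_nonneg[of "-1"] by (metis abs_of_nonneg abs_square_eq_1 power2_eq_square)
  then show ?thesis using v_mult[of "-1" x] by simp
qed

lemma v_minus_commute: "v (x - y) = v (y - x)"
  using v_uminus[of "x - y"] by simp

lemma v_diff: "v (x - y) \<le> max (v x) (v y)"
  using v_add[of x "- y"] by simp

lemma v_add_le: "v x \<le> B \<Longrightarrow> v y \<le> B \<Longrightarrow> v (x + y) \<le> B"
  using v_add[of x y] by simp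

lemma v_diff_le: "v x \<le> B \<Longrightarrow> v y \<le> B \<Longrightarrow> v (x - y) \<le> B"
  using v_diff[of x y] by simp

text \<open>The isosceles principle: y is (x + y) - x, so a smaller value of the sum would force
  \<open>v y\<close> below itself. The domination arguments below rest on it.\<close>

lemma v_add_eq: "v x < v y \<Longrightarrow> v (x + y) = v y"
  using v_add[of x y] v_diff[of "x + y" x] by (auto simp: max_def split: if_splits)

lemma v_power [simp]: "v (x ^ n) = v x ^ n"
  by (induction n) auto

lemma v_inverse [simp]: "v (inverse x) = inverse (v x)"
proof (cases "x = 0")
  case False
  then have "v x * v (inverse x) = 1" by (simp flip: v_mult)
  then show ?thesis by (simp add: inverse_unique)
qed auto

lemma v_divide [simp]: "v (x / y) = v x / v y"
  by (simp add: divide_inverse)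

lemma v_sum_le: "(\<And>i. i \<in> A \<Longrightarrow> v (f i) \<le> B) \<Longrightarrow> 0 \<le> B \<Longrightarrow> v (sum f A) \<le> B"
  by (induction A rule: infinite_finite_induct) (auto intro: v_add_le)

lemma v_prod_mset: "v (\<Prod>x\<in>#M. f x) = (\<Prod>x\<in>#M. v (f x))"
  by (induction M) auto

text \<open>Non-triviality makes the values unbounded, by powers of an element or of its inverse.
  Hence convergence at all points of the field controls every real radius.\<close>

lemma ex_v_gt: "\<exists>z. B < v z"
proof -
  obtain x where x: "v x \<noteq> 0" "v x \<noteq> 1" using nontrivial unfolding nontrivial_abs_def by auto
  define y where "y = (if v x > 1 then x else inverse x)"
  have "v y > 1"
    using x v_nonneg[of x] v_pos[of x]
    by (auto simp: y_def one_less_inverse_iff)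
  then obtain n where "B < v y ^ n" using real_arch_pow by blast
  then show ?thesis by (metis v_power)
qed

lemma ex_v_small: "0 < e \<Longrightarrow> \<exists>z. z \<noteq> 0 \<and> v z < e"
proof -
  assume e: "0 < e"
  obtain z where z: "inverse e < v z" using ex_v_gt by blast
  with e have "z \<noteq> 0" by auto
  moreover have "v (inverse z) < e" using z e
    by (metis inverse_inverse_eq less_imp_inverse_less positive_imp_inverse_positive v_inverse)
  ultimately show ?thesis by (intro exI[of _ "inverse z"]) auto
qed

section \<open>Limits and convergent series\<close>

definition vlim :: "(nat \<Rightarrow> 'a) \<Rightarrow> 'a \<Rightarrow> bool" where
  "vlim X L \<longleftrightarrow> (\<lambda>n. v (X n - L)) \<longlonglongrightarrow> 0"

lemma vlim_squeeze:
  assumes "\<forall>\<^sub>F n in sequentially. v (X n - L) \<le> u n" "u \<longlonglongrightarrow> 0"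
  shows "vlim X L"
  unfolding vlim_def
  by (rule tendsto_sandwich[OF _ assms(1) tendsto_const assms(2)]) auto

lemma vlim_unique:
  assumes "vlim X L" "vlim X M"
  shows "L = M"
proof -
  have "(\<lambda>n. v (X n - L) + v (X n - M)) \<longlonglongrightarrow> 0 + 0"
    using assms unfolding vlim_def by (intro tendsto_add)
  then have "v (L - M) \<le> 0 + 0"
  proof (rule tendsto_lowerbound)
    have "v (L - M) \<le> v (X n - L) + v (X n - M)" for n
      using v_diff[of "X n - M" "X n - L"] v_nonneg[of "X n - L"] v_nonneg[of "X n - M"]
      by (simp add: max_def del: v_nonneg split: if_splits)
    then show "\<forall>\<^sub>F n in sequentially. v (L - M) \<le> v (X n - L) + v (X n - M)" by simp
  qed simp
  then show ?thesis using v_nonneg[of "L - M"] v_eq_0[of "L - M"] by simp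
qed

lemma vlim_add:
  assumes "vlim X L" "vlim Y M"
  shows "vlim (\<lambda>n. X n + Y n) (L + M)"
proof (rule vlim_squeeze)
  show "(\<lambda>n. v (X n - L) + v (Y n - M)) \<longlonglongrightarrow> 0"
    using tendsto_add[OF assms[unfolded vlim_def]] by simp
  have "v (X n + Y n - (L + M)) \<le> v (X n - L) + v (Y n - M)" for n
    using v_add[of "X n - L" "Y n - M"] v_nonneg[of "X n - L"] v_nonneg[of "Y n - M"]
    by (simp add: add_diff_add max_def del: v_nonneg split: if_splits)
  then show "\<forall>\<^sub>F n in sequentially. v (X n + Y n - (L + M)) \<le> v (X n - L) + v (Y n - M)" by simp
qed

lemma vlim_mult_left:
  assumes "vlim X L" shows "vlim (\<lambda>n. c * X n) (c * L)"
proof -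
  have "(\<lambda>n. v c * v (X n - L)) \<longlonglongrightarrow> v c * 0"
    using assms unfolding vlim_def by (intro tendsto_mult tendsto_const)
  then show ?thesis unfolding vlim_def by (simp flip: v_mult right_diff_distrib)
qed

lemma vlim_diff:
  assumes "vlim X L" "vlim Y M"
  shows "vlim (\<lambda>n. X n - Y n) (L - M)"
  using vlim_add[OF assms(1) vlim_mult_left[OF assms(2), of "-1"]] by simp

text \<open>If \<open>v (L - K)\<close> exceeded B, the isosceles principle would make
  \<open>v (X n - K)\<close> equal to it for large n.\<close>

lemma vlim_bound:
  assumes "vlim X L" "\<forall>\<^sub>F n in sequentially. v (X n - K) \<le> B"
  shows "v (L - K) \<le> B"
proof (rule ccontr)
  assume A: "\<not> ?thesis"
  have "\<forall>\<^sub>F n in sequentially. v (X n - L) < v (L - K)"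
  proof (rule order_tendstoD(2)[OF assms(1)[unfolded vlim_def]])
    have "0 \<le> B" using eventually_happens[OF assms(2)] by (auto intro: order_trans[OF v_nonneg])
    then show "0 < v (L - K)" using A by linarith
  qed
  with assms(2) have "\<forall>\<^sub>F n in sequentially. False"
  proof eventually_elim
    case (elim n)
    then show ?case using v_add_eq[of "X n - L" "L - K"] A by simp
  qed
  then show False by simp
qed

text \<open>Consecutive differences suffice in an ultrametric, because a telescoping sum is bounded
  by its largest term. Completeness enters here.\<close>

lemma vlim_exists:
  assumes "(\<lambda>n. v (X (Suc n) - X n)) \<longlonglongrightarrow> 0"
  shows "\<exists>L. vlim X L"
proof -
  have "\<exists>N. \<forall>m\<ge>N. \<forall>n\<ge>N. v (X m - X n) < e" if e: "e > 0" for e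
  proof -
    obtain N where N: "\<And>n. n \<ge> N \<Longrightarrow> v (X (Suc n) - X n) \<le> e / 2"
      using order_tendstoD(2)[OF assms, of "e / 2"] e
      by (auto simp: eventually_sequentially intro: less_imp_le)
    have *: "v (X m - X N) \<le> e / 2" if "m \<ge> N" for m
      using that
    proof (induction m rule: dec_induct)
      case base
      then show ?case using e by simp
    next
      case (step k)
      then show ?case using v_add_le[OF N[of k] step.IH] by simp
    qed
    have "v (X m - X n) \<le> e / 2" if "m \<ge> N" "n \<ge> N" for m n
      using v_diff_le[OF *[OF that(1)] *[OF that(2)]] by simp
    then show ?thesis using e by (intro exI[of _ N]) (smt (verit) field_sum_of_halves)
  qed
  then show ?thesis using complete unfolding abs_complete_def vlim_def by blast
qed

lemma abs_sums_iff: "abs_sums v u s \<longleftrightarrow> vlim (\<lambda>N. \<Sum>n<N. u n) s"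
  unfolding abs_sums_def vlim_def by (subst v_minus_commute) simp

lemma abs_sums_exists:
  assumes "(\<lambda>n. v (u n)) \<longlonglongrightarrow> 0"
  shows "\<exists>s. abs_sums v u s"
  unfolding abs_sums_iff by (rule vlim_exists) (use assms in simp)

lemma abs_sums_null:
  assumes "abs_sums v u s"
  shows "(\<lambda>n. v (u n)) \<longlonglongrightarrow> 0"
proof -
  have A: "vlim (\<lambda>N. \<Sum>n<N. u n) s" using assms by (simp add: abs_sums_iff)
  then have "vlim (\<lambda>N. \<Sum>n<Suc N. u n) s" unfolding vlim_def by (rule LIMSEQ_Suc)
  from vlim_diff[OF this A] show ?thesis by (simp add: vlim_def)
qed

subsection \<open>Entire functions and the Gauss norm\<close>

text \<open>The terms of a convergent series vanish in the limit and, ultrametrically, that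
  suffices. A real radius R need not be a value of \<open>v\<close>, so it is dominated by a point
  beyond it.\<close>

lemma entire_iff: "entire v G \<longleftrightarrow> (\<forall>R>0. (\<lambda>n. v (fps_nth G n) * R ^ n) \<longlonglongrightarrow> 0)"
proof
  assume E: "entire v G"
  show "\<forall>R>0. (\<lambda>n. v (fps_nth G n) * R ^ n) \<longlonglongrightarrow> 0"
  proof (intro allI impI)
    fix R :: real assume R: "R > 0"
    obtain z where z: "R < v z" using ex_v_gt by blast
    obtain s where "abs_sums v (\<lambda>n. fps_nth G n * z ^ n) s" using E unfolding entire_def by blast
    from abs_sums_null[OF this] have L: "(\<lambda>n. v (fps_nth G n) * v z ^ n) \<longlonglongrightarrow> 0" by simp
    show "(\<lambda>n. v (fps_nth G n) * R ^ n) \<longlonglongrightarrow> 0"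
    proof (rule tendsto_sandwich[OF _ _ tendsto_const L])
      show "\<forall>\<^sub>F n in sequentially. 0 \<le> v (fps_nth G n) * R ^ n" using R by simp
      show "\<forall>\<^sub>F n in sequentially. v (fps_nth G n) * R ^ n \<le> v (fps_nth G n) * v z ^ n"
        using R z by (intro always_eventually allI mult_left_mono power_mono) auto
    qed
  qed
next
  assume L: "\<forall>R>0. (\<lambda>n. v (fps_nth G n) * R ^ n) \<longlonglongrightarrow> 0"
  show "entire v G" unfolding entire_def
  proof
    fix z
    have "v z + 1 > 0" using v_nonneg[of z] by linarith
    then have L: "(\<lambda>n. v (fps_nth G n) * (v z + 1) ^ n) \<longlonglongrightarrow> 0" using L by blast
    show "\<exists>s. abs_sums v (\<lambda>n. fps_nth G n * z ^ n) s"
    proof (intro abs_sums_exists tendsto_sandwich[OF _ _ tendsto_const L])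
      show "\<forall>\<^sub>F n in sequentially. v (fps_nth G n * z ^ n) \<le> v (fps_nth G n) * (v z + 1) ^ n"
        by (intro always_eventually allI) (auto intro!: mult_left_mono power_mono)
    qed auto
  qed
qed

lemma entireD: "entire v G \<Longrightarrow> 0 < R \<Longrightarrow> (\<lambda>n. v (fps_nth G n) * R ^ n) \<longlonglongrightarrow> 0"
  by (simp add: entire_iff)

lemma entire_eventually_less:
  "entire v G \<Longrightarrow> 0 < R \<Longrightarrow> 0 < e \<Longrightarrow> \<exists>N. \<forall>n\<ge>N. v (fps_nth G n) * R ^ n < e"
  using order_tendstoD(2)[OF entireD, of G R e] by (simp add: eventually_sequentially)

lemma entire_if_eventually_le:
  assumes "\<And>R e. 0 < R \<Longrightarrow> 0 < e \<Longrightarrow> \<exists>N. \<forall>n\<ge>N. v (fps_nth G n) * R ^ n \<le> e"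
  shows "entire v G"
  unfolding entire_iff
proof (intro allI impI order_tendstoI)
  fix R e :: real assume R: "R > 0" and e: "0 < e"
  obtain N where "\<forall>n\<ge>N. v (fps_nth G n) * R ^ n \<le> e / 2" using assms[OF R, of "e / 2"] e by auto
  then show "\<forall>\<^sub>F n in sequentially. v (fps_nth G n) * R ^ n < e"
    unfolding eventually_sequentially using e by (intro exI[of _ N]) (smt (verit) field_sum_of_halves)
next
  fix R e :: real assume R: "R > 0" and e: "e < 0"
  have "0 \<le> v (fps_nth G n) * R ^ n" for n using R by simp
  then show "\<forall>\<^sub>F n in sequentially. e < v (fps_nth G n) * R ^ n"
    using e by (intro always_eventually allI) (meson less_le_trans)
qed

lemma mu_bdd: "entire v G \<Longrightarrow> 0 < R \<Longrightarrow> bdd_above (range (\<lambda>n. v (fps_nth G n) * R ^ n))"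
  using entireD[of G R] convergent_imp_Bseq[of "\<lambda>n. v (fps_nth G n) * R ^ n"]
  by (metis Bseq_eq_bounded bounded_imp_bdd_above convergentI)

lemma mu_ge: "entire v G \<Longrightarrow> 0 < R \<Longrightarrow> v (fps_nth G n) * R ^ n \<le> mu_entire v R G"
  unfolding mu_entire_def by (rule cSUP_upper[OF UNIV_I mu_bdd])

lemma mu_le: "(\<And>n. v (fps_nth G n) * R ^ n \<le> B) \<Longrightarrow> mu_entire v R G \<le> B"
  unfolding mu_entire_def by (rule cSUP_least) auto

lemma mu_nonneg: "entire v G \<Longrightarrow> 0 < R \<Longrightarrow> 0 \<le> mu_entire v R G"
  using order_trans[OF v_nonneg, of "fps_nth G 0"] mu_ge[of G R 0] by simp

lemma mu_pos:
  assumes "entire v G" "0 < R" "G \<noteq> 0" shows "0 < mu_entire v R G"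
proof -
  obtain n where "fps_nth G n \<noteq> 0" using assms(3) by (auto simp: fps_eq_iff)
  then have "0 < v (fps_nth G n) * R ^ n" using assms(2) by (simp add: v_pos)
  also have "\<dots> \<le> mu_entire v R G" by (rule mu_ge[OF assms(1,2)])
  finally show ?thesis .
qed

text \<open>The terms tend to 0, so the supremum is a maximum. The first maximising index is what
  \<open>mu_mult\<close> needs to isolate a dominant product.\<close>

lemma mu_attained_first:
  assumes "entire v G" "0 < R"
  obtains n where "v (fps_nth G n) * R ^ n = mu_entire v R G"
    "\<And>k. k < n \<Longrightarrow> v (fps_nth G k) * R ^ k < mu_entire v R G"
proof -
  let ?u = "\<lambda>n. v (fps_nth G n) * R ^ n"
  have "\<exists>n. ?u n = mu_entire v R G"
  proof (cases "mu_entire v R G = 0")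
    case True
    then show ?thesis using mu_ge[OF assms, of 0] v_nonneg[of "fps_nth G 0"] by (intro exI[of _ 0]) simp
  next
    case False
    then have pos: "0 < mu_entire v R G" using mu_nonneg[OF assms] by simp
    then obtain N where N: "\<forall>n\<ge>N. ?u n < mu_entire v R G / 2"
      using entire_eventually_less[OF assms, of "mu_entire v R G / 2"] by auto
    \<comment> \<open>Half the norm caps the tail; as M is at least the norm, the maximum must be
      one of the finitely many initial terms.\<close>
    define M where "M = Max (insert (mu_entire v R G / 2) (?u ` {..<N}))"
    have "?u n \<le> M" for n
    proof (cases "n < N")
      case True then show ?thesis unfolding M_def by (intro Max_ge) auto
    next
      case False
      then have "?u n \<le> mu_entire v R G / 2" using N by (simp add: less_imp_le)
      also have "\<dots> \<le> M" unfolding M_def by (intro Max_ge) auto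
      finally show ?thesis .
    qed
    then have le: "mu_entire v R G \<le> M" by (rule mu_le)
    have "M \<in> insert (mu_entire v R G / 2) (?u ` {..<N})" unfolding M_def by (rule Max_in) auto
    then have "M \<in> ?u ` {..<N}" using le pos by auto
    then obtain n where "M = ?u n" by auto
    then show ?thesis using le mu_ge[OF assms, of n] by (intro exI[of _ n]) linarith
  qed
  then have L: "?u (LEAST n. ?u n = mu_entire v R G) = mu_entire v R G" by (rule LeastI_ex)
  show ?thesis
  proof (rule that[OF L])
    fix k assume "k < (LEAST n. ?u n = mu_entire v R G)"
    then have "?u k \<noteq> mu_entire v R G" by (rule not_less_Least)
    then show "?u k < mu_entire v R G" using mu_ge[OF assms, of k] by linarith
  qed
qed

lemma entire_add:
  assumes "entire v G" "entire v H" shows "entire v (G + H)"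
proof (rule entire_if_eventually_le)
  fix R e :: real assume R: "0 < R" and e: "0 < e"
  obtain N1 where N1: "\<forall>n\<ge>N1. v (fps_nth G n) * R ^ n < e" using entire_eventually_less[OF assms(1) R e] by blast
  obtain N2 where N2: "\<forall>n\<ge>N2. v (fps_nth H n) * R ^ n < e" using entire_eventually_less[OF assms(2) R e] by blast
  show "\<exists>N. \<forall>n\<ge>N. v (fps_nth (G + H) n) * R ^ n \<le> e"
  proof (intro exI allI impI)
    fix n assume "max N1 N2 \<le> n"
    then have A: "v (fps_nth G n) \<le> e / R ^ n" "v (fps_nth H n) \<le> e / R ^ n"
      using N1 N2 R by (simp_all add: pos_le_divide_eq less_imp_le)
    show "v (fps_nth (G + H) n) * R ^ n \<le> e" using v_add_le[OF A] R by (simp add: pos_le_divide_eq)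
  qed
qed

lemma mult_coeff_le:
  assumes R: "0 < R" and "0 \<le> B"
    and "\<And>i. i \<le> n \<Longrightarrow> (v (fps_nth G i) * R ^ i) * (v (fps_nth H (n - i)) * R ^ (n - i)) \<le> B"
  shows "v (fps_nth (G * H) n) * R ^ n \<le> B"
proof -
  have "v (fps_nth (G * H) n) \<le> B / R ^ n"
    unfolding fps_mult_nth
  proof (rule v_sum_le)
    fix i assume i: "i \<in> {0..n}"
    then have "R ^ n = R ^ i * R ^ (n - i)" by (simp flip: power_add)
    with assms(3)[of i] i R show "v (fps_nth G i * fps_nth H (n - i)) \<le> B / R ^ n"
      by (simp add: pos_le_divide_eq mult_ac)
  qed (use assms in simp)
  then show ?thesis using R by (simp add: pos_le_divide_eq)
qed

text \<open>In a coefficient of index at least N1 + N2 each product has one factor in a tail, below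
  e / A, while A bounds the other factor.\<close>

lemma entire_mult:
  assumes G: "entire v G" and H: "entire v H" shows "entire v (G * H)"
proof (rule entire_if_eventually_le)
  fix R e :: real assume R: "0 < R" and e: "0 < e"
  let ?g = "\<lambda>n. v (fps_nth G n) * R ^ n" and ?h = "\<lambda>n. v (fps_nth H n) * R ^ n"
  define A where "A = 1 + mu_entire v R G + mu_entire v R H"
  have m: "0 \<le> mu_entire v R G" "0 \<le> mu_entire v R H" using mu_nonneg R G H by auto
  then have A: "A > 0" "mu_entire v R G \<le> A" "mu_entire v R H \<le> A" by (auto simp: A_def)
  have gA: "0 \<le> ?g i" "?g i \<le> A" "0 \<le> ?h i" "?h i \<le> A" for i
    using mu_ge[OF G R, of i] mu_ge[OF H R, of i] A R by auto
  obtain N1 where N1: "\<forall>n\<ge>N1. ?g n < e / A" using entire_eventually_less[OF G R, of "e / A"] e A by auto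
  obtain N2 where N2: "\<forall>n\<ge>N2. ?h n < e / A" using entire_eventually_less[OF H R, of "e / A"] e A by auto
  show "\<exists>N. \<forall>n\<ge>N. v (fps_nth (G * H) n) * R ^ n \<le> e"
  proof (intro exI allI impI mult_coeff_le[OF R])
    fix n i assume n: "N1 + N2 \<le> n" and i: "i \<le> n"
    show "?g i * ?h (n - i) \<le> e"
    proof (cases "i \<ge> N1")
      case True
      then have "?g i * ?h (n - i) \<le> (e / A) * A"
        using N1 gA e A by (intro mult_mono) (auto simp: less_imp_le)
      then show ?thesis using A by simp
    next
      case False
      then have "n - i \<ge> N2" using n by simp
      then have "?g i * ?h (n - i) \<le> A * (e / A)"
        using N2 gA e A by (intro mult_mono) (auto simp: less_imp_le)
      then show ?thesis using A by simp
    qed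
  qed (use e in simp)
qed

lemma entire_poly [simp]: "entire v (fps_of_poly p)"
proof (rule entire_if_eventually_le)
  fix R e :: real assume "0 < e"
  then show "\<exists>N. \<forall>n\<ge>N. v (fps_nth (fps_of_poly p) n) * R ^ n \<le> e"
    by (intro exI[of _ "Suc (degree p)"]) (auto simp: coeff_eq_0)
qed

lemma entire_const [simp]: "entire v (fps_const c)"
  using entire_poly[of "[:c:]"] by (simp add: fps_of_poly_const)

lemma entire_0 [simp]: "entire v 0" using entire_const[of 0] by simp
lemma entire_1 [simp]: "entire v 1" using entire_const[of 1] by simp
lemma entire_X [simp]: "entire v fps_X" using entire_poly[of "[:0,1:]"] by (simp add: fps_of_poly_pCons)

lemma entire_uminus: "entire v G \<Longrightarrow> entire v (- G)"
  by (simp add: entire_iff)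

lemma entire_diff: "entire v G \<Longrightarrow> entire v H \<Longrightarrow> entire v (G - H)"
  using entire_add[OF _ entire_uminus, of G H] by simp

lemma entire_power: "entire v G \<Longrightarrow> entire v (G ^ n)"
  by (induction n) (auto intro: entire_mult)

lemma entire_prod_mset: "(\<And>x. x \<in># M \<Longrightarrow> entire v (f x)) \<Longrightarrow> entire v (\<Prod>x\<in>#M. f x)"
  by (induction M) (auto intro: entire_mult)

lemmas entire_intros = entire_add entire_diff entire_uminus entire_mult entire_power entire_poly
  entire_const entire_0 entire_1 entire_X

lemma mu_add_le:
  assumes "entire v G" "entire v H" "0 < R" "mu_entire v R G \<le> B" "mu_entire v R H \<le> B"
  shows "mu_entire v R (G + H) \<le> B"
proof (rule mu_le)
  fix n
  have "v (fps_nth G n) \<le> B / R ^ n" "v (fps_nth H n) \<le> B / R ^ n"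
    using mu_ge[OF assms(1,3), of n] mu_ge[OF assms(2,3), of n] assms by (simp_all add: pos_le_divide_eq)
  then have "v (fps_nth (G + H) n) \<le> B / R ^ n" using v_add_le by simp
  then show "v (fps_nth (G + H) n) * R ^ n \<le> B" using assms(3) by (simp add: pos_le_divide_eq)
qed

text \<open>Gauss's lemma. If i and j are the first indices attaining the two norms, the product
  with indices i and j strictly dominates the coefficient of index i + j: for k < i the first factor
  is too small, for k > i the second.\<close>

lemma mu_mult:
  assumes G: "entire v G" and H: "entire v H" and R: "0 < R"
  shows "mu_entire v R (G * H) = mu_entire v R G * mu_entire v R H"
proof (cases "G = 0 \<or> H = 0")
  case True
  then show ?thesis by (auto simp: mu_entire_def)
next
  case False
  let ?g = "\<lambda>n. v (fps_nth G n) * R ^ n" and ?h = "\<lambda>n. v (fps_nth H n) * R ^ n"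
  let ?mg = "mu_entire v R G" and ?mh = "mu_entire v R H"
  have gn: "0 \<le> ?g i" "0 \<le> ?h i" for i using R by auto
  have pos: "0 < ?mg" "0 < ?mh" using mu_pos assms False by auto
  obtain i where i: "?g i = ?mg" "\<And>k. k < i \<Longrightarrow> ?g k < ?mg" using mu_attained_first[OF G R] by blast
  obtain j where j: "?h j = ?mh" "\<And>k. k < j \<Longrightarrow> ?h k < ?mh" using mu_attained_first[OF H R] by blast
  let ?c = "\<lambda>k. fps_nth G k * fps_nth H (i + j - k)"
  have pw: "R ^ (i + j) = R ^ k * R ^ (i + j - k)" if "k \<le> i + j" for k using that by (simp flip: power_add)
  have main: "v (?c i) * R ^ (i + j) = ?mg * ?mh" using i(1) j(1) by (simp add: power_add mult_ac)
  have small: "v (?c k) * R ^ (i + j) < ?mg * ?mh" if k: "k \<le> i + j" "k \<noteq> i" for k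
  proof -
    have "v (?c k) * R ^ (i + j) = ?g k * ?h (i + j - k)" using pw[OF k(1)] by (simp add: mult_ac)
    also have "\<dots> < ?mg * ?mh"
    proof (cases "k < i")
      case True
      have "?g k * ?h (i + j - k) \<le> ?g k * ?mh" using mu_ge[OF H R] gn by (intro mult_left_mono) auto
      also have "\<dots> < ?mg * ?mh" using i(2)[OF True] pos by simp
      finally show ?thesis .
    next
      case False
      then have "i + j - k < j" using k by simp
      have "?g k * ?h (i + j - k) \<le> ?mg * ?h (i + j - k)" using mu_ge[OF G R] gn by (intro mult_right_mono) auto
      also have "\<dots> < ?mg * ?mh" using j(2)[OF \<open>i + j - k < j\<close>] pos by simp
      finally show ?thesis .
    qed
    finally show ?thesis .
  qed
  define S where "S = (\<Sum>k\<in>{0..i+j} - {i}. ?c k)"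
  have tot: "fps_nth (G * H) (i + j) = S + ?c i"
    unfolding fps_mult_nth S_def by (subst sum.remove[of _ i]) auto
  \<comment> \<open>A finite maximum keeps the strict inequality for the whole sum; the entry 0
    covers an empty range.\<close>
  define B where "B = Max (insert 0 ((\<lambda>k. v (?c k)) ` ({0..i+j} - {i})))"
  have "B \<in> insert 0 ((\<lambda>k. v (?c k)) ` ({0..i+j} - {i}))" unfolding B_def by (rule Max_in) auto
  then have B: "B * R ^ (i + j) < ?mg * ?mh" using small pos by force
  have "v S \<le> B" unfolding S_def by (rule v_sum_le) (auto simp: B_def)
  then have "v S * R ^ (i + j) < v (?c i) * R ^ (i + j)"
    using B main R by (metis (no_types, lifting) dual_order.strict_trans2 less_eq_real_def mult_right_mono zero_le_power)
  then have "v S < v (?c i)" using R by (simp del: v_mult)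
  from v_add_eq[OF this] have "v (fps_nth (G * H) (i + j)) * R ^ (i + j) = ?mg * ?mh"
    using main tot by simp
  then have ge: "?mg * ?mh \<le> mu_entire v R (G * H)"
    using mu_ge[OF entire_mult[OF G H] R, of "i + j"] by simp
  have "mu_entire v R (G * H) \<le> ?mg * ?mh"
  proof (intro mu_le mult_coeff_le[OF R])
    fix n k
    show "?g k * ?h (n - k) \<le> ?mg * ?mh"
      using mu_ge[OF G R, of k] mu_ge[OF H R, of "n - k"] gn pos by (intro mult_mono) auto
  qed (use pos in simp)
  with ge show ?thesis by simp
qed

lemma mu_const [simp]: "0 < R \<Longrightarrow> mu_entire v R (fps_const c) = v c"
  using mu_ge[of "fps_const c" R 0] by (intro antisym mu_le) auto

lemma mu_0 [simp]: "mu_entire v R 0 = 0" by (simp add: mu_entire_def)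
lemma mu_1 [simp]: "0 < R \<Longrightarrow> mu_entire v R 1 = 1" using mu_const[of R 1] by simp

lemma mu_prod_mset:
  "(\<And>x. x \<in># M \<Longrightarrow> entire v (f x)) \<Longrightarrow> 0 < R \<Longrightarrow>
    mu_entire v R (\<Prod>x\<in>#M. f x) = (\<Prod>x\<in>#M. mu_entire v R (f x))"
  by (induction M) (auto simp: mu_mult entire_prod_mset)

lemma mu_mono:
  assumes "entire v G" "0 < r" "r \<le> R" shows "mu_entire v r G \<le> mu_entire v R G"
proof (rule mu_le)
  fix n
  have "v (fps_nth G n) * r ^ n \<le> v (fps_nth G n) * R ^ n"
    using assms by (intro mult_left_mono power_mono) auto
  also have "\<dots> \<le> mu_entire v R G" using assms by (intro mu_ge) auto
  finally show "v (fps_nth G n) * r ^ n \<le> mu_entire v R G" .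
qed

lemma mu_linear:
  assumes "0 < R" shows "mu_entire v R (fps_of_poly [:b, a:]) = max (v b) (v a * R)"
proof (rule antisym)
  show "mu_entire v R (fps_of_poly [:b, a:]) \<le> max (v b) (v a * R)"
  proof (rule mu_le)
    fix n :: nat
    consider "n = 0" | "n = 1" | "n \<ge> 2" by linarith
    then show "v (fps_nth (fps_of_poly [:b, a:]) n) * R ^ n \<le> max (v b) (v a * R)"
      by cases (auto simp: coeff_eq_0 coeff_pCons le_max_iff_disj split: nat.split)
  qed
  show "max (v b) (v a * R) \<le> mu_entire v R (fps_of_poly [:b, a:])"
    using mu_ge[of "fps_of_poly [:b, a:]" R 0] mu_ge[of "fps_of_poly [:b, a:]" R 1] assms by auto
qed

subsection \<open>Evaluation\<close>

lemma ev_eqI: "abs_sums v (\<lambda>n. fps_nth G n * z ^ n) s \<Longrightarrow> entire_eval v G z = s"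
  unfolding entire_eval_def by (rule the_equality) (auto simp: abs_sums_iff intro: vlim_unique)

lemma ev_sums: "entire v G \<Longrightarrow> vlim (\<lambda>N. \<Sum>n<N. fps_nth G n * z ^ n) (entire_eval v G z)"
  unfolding entire_def abs_sums_iff[symmetric] using ev_eqI[of G z] by metis

lemma ev_poly [simp]: "entire_eval v (fps_of_poly p) z = poly p z"
proof (rule ev_eqI)
  have "(\<Sum>n<N. coeff p n * z ^ n) = poly p z" if "N \<ge> Suc (degree p)" for N
  proof -
    have "(\<Sum>n<N. coeff p n * z ^ n) = (\<Sum>n\<le>degree p. coeff p n * z ^ n)"
      using that by (intro sum.mono_neutral_right) (auto simp: coeff_eq_0)
    then show ?thesis by (simp add: poly_altdef)
  qed
  then have "\<forall>\<^sub>F N in sequentially. v ((\<Sum>n<N. coeff p n * z ^ n) - poly p z) \<le> 0"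
    unfolding eventually_sequentially by (intro exI[of _ "Suc (degree p)"]) simp
  then show "abs_sums v (\<lambda>n. fps_nth (fps_of_poly p) n * z ^ n) (poly p z)"
    unfolding abs_sums_iff by (auto intro!: vlim_squeeze[where u = "\<lambda>_. 0"])
qed

lemma ev_add:
  "entire v G \<Longrightarrow> entire v H \<Longrightarrow> entire_eval v (G + H) z = entire_eval v G z + entire_eval v H z"
  using vlim_add[OF ev_sums ev_sums, of G H z z]
  by (intro ev_eqI) (simp add: abs_sums_iff sum.distrib algebra_simps)

lemma ev_diff:
  "entire v G \<Longrightarrow> entire v H \<Longrightarrow> entire_eval v (G - H) z = entire_eval v G z - entire_eval v H z"
  using vlim_diff[OF ev_sums ev_sums, of G H z z]
  by (intro ev_eqI) (simp add: abs_sums_iff sum_subtractf algebra_simps)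

lemma ev_bound:
  assumes "entire v G" "0 < R" "v z \<le> R"
  shows "v (entire_eval v G z) \<le> mu_entire v R G"
proof -
  have "v (\<Sum>n<N. fps_nth G n * z ^ n) \<le> mu_entire v R G" for N
  proof (rule v_sum_le)
    fix n
    have "v (fps_nth G n * z ^ n) \<le> v (fps_nth G n) * R ^ n"
      using assms by (auto intro!: mult_left_mono power_mono)
    also have "\<dots> \<le> mu_entire v R G" using assms by (intro mu_ge) auto
    finally show "v (fps_nth G n * z ^ n) \<le> mu_entire v R G" .
  qed (use mu_nonneg assms in simp)
  then show ?thesis using vlim_bound[OF ev_sums[OF assms(1)], where K = 0] by simp
qed

text \<open>Convergence in Gauss norm is uniform on the disc; identities pass through it from
  truncations to entire functions.\<close>

lemma ev_limit:
  assumes "entire v G" "\<And>N. entire v (P N)" "(\<lambda>N. mu_entire v R (G - P N)) \<longlonglongrightarrow> 0" "0 < R" "v z \<le> R"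
  shows "vlim (\<lambda>N. entire_eval v (P N) z) (entire_eval v G z)"
proof (rule vlim_squeeze[OF _ assms(3)])
  have "v (entire_eval v (P N) z - entire_eval v G z) \<le> mu_entire v R (G - P N)" for N
    using ev_bound[of "G - P N" R z] assms by (simp add: ev_diff entire_intros v_minus_commute)
  then show "\<forall>\<^sub>F N in sequentially. v (entire_eval v (P N) z - entire_eval v G z) \<le> mu_entire v R (G - P N)"
    by simp
qed

text \<open>Typed as a polynomial, so that polynomial composition and the existence of roots apply
  to it.\<close>

definition trunc :: "nat \<Rightarrow> 'a fps \<Rightarrow> 'a poly" where
  "trunc N G = (\<Sum>n<N. monom (fps_nth G n) n)"

lemma coeff_trunc: "coeff (trunc N G) k = (if k < N then fps_nth G k else 0)"
  by (simp add: trunc_def coeff_sum)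

lemma mu_trunc_le: "entire v G \<Longrightarrow> 0 < R \<Longrightarrow> mu_entire v R (fps_of_poly (trunc N G)) \<le> mu_entire v R G"
  by (rule mu_le) (auto simp: coeff_trunc mu_ge mu_nonneg)

lemma mu_trunc_tendsto:
  assumes "entire v G" "0 < R"
  shows "(\<lambda>N. mu_entire v R (G - fps_of_poly (trunc N G))) \<longlonglongrightarrow> 0"
proof (rule order_tendstoI)
  fix e :: real assume e: "0 < e"
  obtain N where N: "\<forall>n\<ge>N. v (fps_nth G n) * R ^ n < e / 2"
    using entire_eventually_less[OF assms, of "e / 2"] e by auto
  have "mu_entire v R (G - fps_of_poly (trunc M G)) < e" if "M \<ge> N" for M
  proof -
    have "mu_entire v R (G - fps_of_poly (trunc M G)) \<le> e / 2"
      using N that e by (intro mu_le) (auto simp: coeff_trunc less_imp_le)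
    then show ?thesis using e by simp
  qed
  then show "\<forall>\<^sub>F N in sequentially. mu_entire v R (G - fps_of_poly (trunc N G)) < e"
    unfolding eventually_sequentially by blast
next
  fix e :: real assume "e < 0"
  then show "\<forall>\<^sub>F N in sequentially. e < mu_entire v R (G - fps_of_poly (trunc N G))"
    using mu_nonneg[OF entire_diff[OF assms(1) entire_poly] assms(2)] by (simp add: less_le_trans)
qed

text \<open>The factors are approximated in turn: truncations of H settle a polynomial left factor,
  truncations of G then the general one.\<close>

lemma ev_mult:
  assumes G: "entire v G" and H: "entire v H"
  shows "entire_eval v (G * H) z = entire_eval v G z * entire_eval v H z"
proof -
  define R where "R = v z + 1"
  have R: "0 < R" "v z \<le> R" using v_nonneg[of z] unfolding R_def by linarith+
  let ?G = "\<lambda>N. trunc N G" and ?H = "\<lambda>N. trunc N H"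
  let ?P = "\<lambda>N. fps_of_poly (?G N)" and ?Q = "\<lambda>N. fps_of_poly (?H N)"
  let ?g = "entire_eval v G z" and ?h = "entire_eval v H z"
  have mn: "0 \<le> mu_entire v R F" if "entire v F" for F using that R mu_nonneg by blast
  have "vlim (\<lambda>N. entire_eval v (?P N * H) z) (entire_eval v (G * H) z)"
  proof (rule ev_limit[OF _ _ _ R])
    have "(\<lambda>N. mu_entire v R (G - ?P N) * mu_entire v R H) \<longlonglongrightarrow> 0 * mu_entire v R H"
      by (intro tendsto_mult mu_trunc_tendsto G R tendsto_const)
    then show "(\<lambda>N. mu_entire v R (G * H - ?P N * H)) \<longlonglongrightarrow> 0"
      using G H R by (simp add: mu_mult[symmetric] entire_intros left_diff_distrib)
  qed (use G H entire_intros in auto)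
  moreover have PH: "entire_eval v (fps_of_poly p * H) z = poly p z * ?h" for p
  proof (rule vlim_unique)
    show "vlim (\<lambda>N. entire_eval v (fps_of_poly p * ?Q N) z) (entire_eval v (fps_of_poly p * H) z)"
    proof (rule ev_limit[OF _ _ _ R])
      have "(\<lambda>N. mu_entire v R (fps_of_poly p) * mu_entire v R (H - ?Q N)) \<longlonglongrightarrow> mu_entire v R (fps_of_poly p) * 0"
        by (intro tendsto_mult mu_trunc_tendsto H R tendsto_const)
      then show "(\<lambda>N. mu_entire v R (fps_of_poly p * H - fps_of_poly p * ?Q N)) \<longlonglongrightarrow> 0"
        using G H R by (simp add: mu_mult[symmetric] entire_intros right_diff_distrib)
    qed (use G H entire_intros in auto)
    have "vlim (\<lambda>N. entire_eval v (?Q N) z) ?h"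
      by (rule ev_limit[OF H _ mu_trunc_tendsto[OF H R(1)] R]) simp
    then show "vlim (\<lambda>N. entire_eval v (fps_of_poly p * ?Q N) z) (poly p z * ?h)"
      by (simp flip: fps_of_poly_mult add: vlim_mult_left)
  qed
  moreover have "vlim (\<lambda>N. ?h * entire_eval v (?P N) z) (?h * ?g)"
    by (intro vlim_mult_left ev_limit[OF G _ mu_trunc_tendsto[OF G R(1)] R]) simp
  ultimately show ?thesis by (simp add: mult.commute vlim_unique)
qed

lemma ev_const [simp]: "entire_eval v (fps_const c) z = c"
  using ev_poly[of "[:c:]" z] by (simp add: fps_of_poly_const)

lemma ev_0 [simp]: "entire_eval v 0 z = 0" using ev_const[of 0] by simp
lemma ev_1 [simp]: "entire_eval v 1 z = 1" using ev_const[of 1] by simp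
lemma ev_X [simp]: "entire_eval v fps_X z = z"
  using ev_poly[of "[:0,1:]" z] by (simp add: fps_of_poly_pCons)

lemma ev_at_0: "entire v G \<Longrightarrow> entire_eval v G 0 = fps_nth G 0"
proof (rule ev_eqI)
  have "(\<Sum>n<N. fps_nth G n * 0 ^ n) = fps_nth G 0" if "N \<ge> 1" for N
    using that by (subst sum.remove[of _ 0]) (auto intro!: sum.neutral)
  then have "\<forall>\<^sub>F N in sequentially. v ((\<Sum>n<N. fps_nth G n * 0 ^ n) - fps_nth G 0) \<le> 0"
    unfolding eventually_sequentially by (intro exI[of _ 1]) simp
  then show "abs_sums v (\<lambda>n. fps_nth G n * 0 ^ n) (fps_nth G 0)"
    unfolding abs_sums_iff by (rule vlim_squeeze) simp
qed

lemma ev_power: "entire v G \<Longrightarrow> entire_eval v (G ^ n) z = entire_eval v G z ^ n"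
  by (induction n) (auto simp: ev_mult entire_power)

lemma entire_fps_shift:
  assumes "entire v G" shows "entire v (fps_shift k G)"
proof (rule entire_if_eventually_le)
  fix R e :: real assume R: "0 < R" and e: "0 < e"
  obtain N where N: "\<forall>n\<ge>N. v (fps_nth G n) * R ^ n < e * R ^ k"
    using entire_eventually_less[OF assms R, of "e * R ^ k"] R e by auto
  show "\<exists>N. \<forall>n\<ge>N. v (fps_nth (fps_shift k G) n) * R ^ n \<le> e"
  proof (intro exI allI impI)
    fix n assume "N \<le> n"
    then have "v (fps_nth G (n + k)) * R ^ n * R ^ k < e * R ^ k"
      using N[rule_format, of "n + k"] by (simp add: power_add mult_ac)
    then show "v (fps_nth (fps_shift k G) n) * R ^ n \<le> e" using R by simp
  qed
qed

lemma fps_split_const: "(G :: 'a fps) = fps_const (fps_nth G 0) + fps_X * fps_shift 1 G"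
  by (rule fps_ext) auto

text \<open>The identity theorem, which makes the description in \<open>entire_comp\<close> unique.
  After a power of X is removed, the nonzero constant term dominates the rest at small nonzero
  points.\<close>

lemma entire_eq_0I:
  assumes E: "entire v H" and z: "\<And>z. entire_eval v H z = 0"
  shows "H = 0"
proof (rule ccontr)
  assume H: "H \<noteq> 0"
  define k where "k = subdegree H"
  define U where "U = fps_shift k H"
  define V where "V = fps_shift 1 U"
  have EU: "entire v U" and EV: "entire v V" using E by (auto simp: U_def V_def intro: entire_fps_shift)
  have HU: "H = U * fps_X ^ k" unfolding U_def k_def by (rule subdegree_decompose)
  have u0: "fps_nth U 0 \<noteq> 0" using H by (simp add: U_def k_def)
  have UV: "U = fps_const (fps_nth U 0) + fps_X * V" unfolding V_def by (rule fps_split_const)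
  have mV: "0 \<le> mu_entire v 1 V" using mu_nonneg[OF EV] by simp
  \<comment> \<open>The bound 1 lets the norm at radius 1 control the value of V at x; adding 1 to
    that norm avoids a zero denominator.\<close>
  obtain x where x: "x \<noteq> 0" "v x < min 1 (v (fps_nth U 0) / (mu_entire v 1 V + 1))"
    using ex_v_small[of "min 1 (v (fps_nth U 0) / (mu_entire v 1 V + 1))"] u0 mV by (auto simp: v_pos)
  have "entire_eval v H x = entire_eval v U x * x ^ k"
    using EU by (subst HU) (simp add: ev_mult ev_power entire_intros)
  then have "entire_eval v U x = 0" using z[of x] x by simp
  moreover have "entire_eval v U x = x * entire_eval v V x + fps_nth U 0"
    by (subst UV) (use EV in \<open>simp add: ev_mult ev_add entire_intros\<close>)
  moreover have "v (x * entire_eval v V x) < v (fps_nth U 0)"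
  proof -
    have "v (x * entire_eval v V x) \<le> v x * mu_entire v 1 V"
      using ev_bound[OF EV, of 1 x] x by (auto intro!: mult_left_mono)
    also have "\<dots> \<le> v x * (mu_entire v 1 V + 1)" by (intro mult_left_mono) auto
    also have "\<dots> < v (fps_nth U 0)" using x mV by (simp add: pos_less_divide_eq)
    finally show ?thesis .
  qed
  ultimately show False using v_add_eq u0 by (metis v_eq_0)
qed

lemma entire_eqI:
  assumes "entire v G" "entire v H" "\<And>z. entire_eval v G z = entire_eval v H z"
  shows "G = H"
  using entire_eq_0I[of "G - H"] assms by (simp add: entire_diff ev_diff)

subsection \<open>Affine substitution\<close>

text \<open>Induction along Horner's scheme: at radius R the linear polynomial has norm at most S,
  and dropping the constant coefficient divides the norm at S by at least S.\<close>

lemma mu_pcompose_le: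
  assumes R: "0 < R" and S: "0 < S" "v b \<le> S" "v a * R \<le> S"
  shows "mu_entire v R (fps_of_poly (pcompose p [:b, a:])) \<le> mu_entire v S (fps_of_poly p)"
proof (induction p)
  case 0
  then show ?case by simp
next
  case (pCons c p)
  let ?L = "[:b, a:]"
  have c: "v c \<le> mu_entire v S (fps_of_poly (pCons c p))"
    using mu_ge[of "fps_of_poly (pCons c p)" S 0] S by simp
  have "mu_entire v S (fps_of_poly p) \<le> mu_entire v S (fps_of_poly (pCons c p)) / S"
  proof (rule mu_le)
    fix n
    show "v (fps_nth (fps_of_poly p) n) * S ^ n \<le> mu_entire v S (fps_of_poly (pCons c p)) / S"
      using mu_ge[of "fps_of_poly (pCons c p)" S "Suc n"] S by (simp add: pos_le_divide_eq mult_ac)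
  qed
  then have p: "S * mu_entire v S (fps_of_poly p) \<le> mu_entire v S (fps_of_poly (pCons c p))"
    using S by (simp add: pos_le_divide_eq mult_ac)
  have "mu_entire v R (fps_of_poly ?L * fps_of_poly (pcompose p ?L)) \<le> S * mu_entire v S (fps_of_poly p)"
    using pCons.IH S R mu_nonneg[of "fps_of_poly (pcompose p ?L)" R]
    by (subst mu_mult) (auto simp: mu_linear intro!: mult_mono)
  then have "mu_entire v R (fps_of_poly [:c:] + fps_of_poly ?L * fps_of_poly (pcompose p ?L))
      \<le> mu_entire v S (fps_of_poly (pCons c p))"
    using c p R by (intro mu_add_le) (auto simp: entire_intros fps_of_poly_const)
  then show ?case
    by (simp only: pcompose_pCons fps_of_poly_add fps_of_poly_mult)
qed

text \<open>Truncations are composed as polynomials, and the new coefficients are the limits of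
  theirs; the Gauss norm of the discarded tail bounds all errors at once. This replaces the
  rearrangement of a double series.\<close>

lemma ex_entire_comp:
  assumes G: "entire v G"
  shows "\<exists>B. entire v B \<and> (\<forall>z. entire_eval v B z = entire_eval v G (a * z + b)) \<and>
    (\<forall>R S. 0 < R \<longrightarrow> 0 < S \<longrightarrow> v b \<le> S \<longrightarrow> v a * R \<le> S \<longrightarrow> mu_entire v R B \<le> mu_entire v S G)"
proof -
  define T where "T N = pcompose (trunc N G) [:b, a:]" for N
  define e where "e N S = mu_entire v S (G - fps_of_poly (trunc N G))" for N S
  have diff: "mu_entire v R (fps_of_poly (T M - T N)) \<le> e N S"
    if "0 < R" "0 < S" "v b \<le> S" "v a * R \<le> S" "N \<le> M" for R S M N
  proof -
    have "T M - T N = pcompose (trunc M G - trunc N G) [:b, a:]" by (simp add: T_def pcompose_diff)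
    then have "mu_entire v R (fps_of_poly (T M - T N)) \<le> mu_entire v S (fps_of_poly (trunc M G - trunc N G))"
      using mu_pcompose_le that by simp
    also have "\<dots> \<le> e N S"
    proof (rule mu_le)
      fix n
      have E: "entire v (G - fps_of_poly (trunc N G))" using G by (simp add: entire_intros)
      show "v (fps_nth (fps_of_poly (trunc M G - trunc N G)) n) * S ^ n \<le> e N S"
        using mu_ge[OF E that(2), of n] mu_nonneg[OF E that(2)] that(5)
        by (auto simp: coeff_trunc e_def)
    qed
    finally show ?thesis .
  qed
  have coeff: "v (coeff (T M) k - coeff (T N) k) \<le> e N S / R ^ k"
    if "0 < R" "0 < S" "v b \<le> S" "v a * R \<le> S" "N \<le> M" for R S M N k
    using order_trans[OF mu_ge[of "fps_of_poly (T M - T N)" R k] diff[OF that]] that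
    by (simp add: pos_le_divide_eq)
  have e0: "(\<lambda>N. e N S) \<longlonglongrightarrow> 0" if "0 < S" for S
    unfolding e_def using mu_trunc_tendsto[OF G that] .
  \<comment> \<open>A radius admissible for R = 1, which is enough for the coefficientwise limits;
    \<open>Sf\<close> later supplies one for every R.\<close>
  define S1 where "S1 = max (v b) (v a) + 1"
  have S1: "0 < S1" "v b \<le> S1" "v a * 1 \<le> S1" using v_nonneg[of b] unfolding S1_def by linarith+
  have "\<exists>L. vlim (\<lambda>N. coeff (T N) k) L" for k
  proof (rule vlim_exists, rule tendsto_sandwich[OF _ _ tendsto_const e0[OF S1(1)]])
    show "\<forall>\<^sub>F N in sequentially. v (coeff (T (Suc N)) k - coeff (T N) k) \<le> e N S1"
      using coeff[of 1 S1 _ "Suc _" k] S1 by (intro always_eventually allI) (metis div_by_1 le_add2 plus_1_eq_Suc power_one zero_less_one)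
  qed auto
  then obtain f where f: "\<And>k. vlim (\<lambda>N. coeff (T N) k) (f k)" by metis
  define B where "B = Abs_fps f"
  have Bc: "v (fps_nth B k - coeff (T N) k) * R ^ k \<le> e N S"
    if "0 < R" "0 < S" "v b \<le> S" "v a * R \<le> S" for R S N k
  proof -
    have "v (f k - coeff (T N) k) \<le> e N S / R ^ k"
      using coeff[OF that] by (intro vlim_bound[OF f]) (auto simp: eventually_sequentially)
    then show ?thesis using that by (simp add: B_def pos_le_divide_eq)
  qed
  define Sf where "Sf R = max (v b) (v a * R) + 1" for R
  have Sf: "0 < Sf R" "v b \<le> Sf R" "v a * R \<le> Sf R" for R
    using v_nonneg[of b] unfolding Sf_def by linarith+
  have EB: "entire v B"
  proof (rule entire_if_eventually_le)
    fix R \<epsilon> :: real assume R: "0 < R" and \<epsilon>: "0 < \<epsilon>"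
    obtain N where N: "e N (Sf R) < \<epsilon>"
      using order_tendstoD(2)[OF e0[OF Sf(1)] \<epsilon>] by (auto simp: eventually_sequentially)
    show "\<exists>K. \<forall>k\<ge>K. v (fps_nth B k) * R ^ k \<le> \<epsilon>"
    proof (intro exI allI impI)
      \<comment> \<open>Beyond the degree of \<open>T N\<close> the coefficient of B is itself the
        approximation error.\<close>
      fix k assume "Suc (degree (T N)) \<le> k"
      then have "coeff (T N) k = 0" by (simp add: coeff_eq_0)
      then show "v (fps_nth B k) * R ^ k \<le> \<epsilon>" using Bc[OF R Sf(1,2,3), of k N] N by simp
    qed
  qed
  have "entire_eval v B z = entire_eval v G (a * z + b)" for z
  proof (rule vlim_unique)
    define R where "R = v z + 1"
    have R: "0 < R" "v z \<le> R" using v_nonneg[of z] unfolding R_def by linarith+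
    show "vlim (\<lambda>N. entire_eval v (fps_of_poly (T N)) z) (entire_eval v B z)"
    proof (rule ev_limit[OF EB _ _ R])
      show "(\<lambda>N. mu_entire v R (B - fps_of_poly (T N))) \<longlonglongrightarrow> 0"
      proof (rule tendsto_sandwich[OF _ _ tendsto_const e0[OF Sf(1)]])
        show "\<forall>\<^sub>F N in sequentially. 0 \<le> mu_entire v R (B - fps_of_poly (T N))"
          using EB R by (simp add: mu_nonneg entire_intros)
        show "\<forall>\<^sub>F N in sequentially. mu_entire v R (B - fps_of_poly (T N)) \<le> e N (Sf R)"
          using Bc[OF R(1) Sf] by (intro always_eventually allI mu_le) simp
      qed
    qed simp
    define R' where "R' = v (a * z + b) + 1"
    have R': "0 < R'" "v (a * z + b) \<le> R'" using v_nonneg[of "a * z + b"] unfolding R'_def by linarith+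
    have "vlim (\<lambda>N. entire_eval v (fps_of_poly (trunc N G)) (a * z + b)) (entire_eval v G (a * z + b))"
      by (rule ev_limit[OF G _ mu_trunc_tendsto[OF G R'(1)] R']) simp
    then show "vlim (\<lambda>N. entire_eval v (fps_of_poly (T N)) z) (entire_eval v G (a * z + b))"
      by (simp add: T_def poly_pcompose add.commute mult.commute)
  qed
  moreover have "mu_entire v R B \<le> mu_entire v S G" if "0 < R" "0 < S" "v b \<le> S" "v a * R \<le> S" for R S
  proof (rule mu_le)
    fix k
    have "v (coeff (T N) k - 0) \<le> mu_entire v S G / R ^ k" for N
    proof -
      have "v (coeff (T N) k) * R ^ k \<le> mu_entire v R (fps_of_poly (T N))"
        using mu_ge[of "fps_of_poly (T N)" R k] that by simp
      also have "\<dots> \<le> mu_entire v S (fps_of_poly (trunc N G))" unfolding T_def using that by (rule mu_pcompose_le)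
      also have "\<dots> \<le> mu_entire v S G" using mu_trunc_le[OF G that(2)] .
      finally show ?thesis using that by (simp add: pos_le_divide_eq)
    qed
    then have "v (f k - 0) \<le> mu_entire v S G / R ^ k" by (intro vlim_bound[OF f]) simp
    then show "v (fps_nth B k) * R ^ k \<le> mu_entire v S G" using that by (simp add: B_def pos_le_divide_eq)
  qed
  ultimately show ?thesis using EB by blast
qed

lemma entire_comp_eqI:
  assumes "entire v H" "\<And>z. entire_eval v H z = entire_eval v G (a * z + b)"
  shows "entire_comp v a b G = H"
  unfolding entire_comp_def
  by (rule the_equality) (use assms in \<open>auto intro: entire_eqI\<close>)

lemma
  assumes "entire v G"
  shows entire_entire_comp: "entire v (entire_comp v a b G)"
    and ev_entire_comp: "entire_eval v (entire_comp v a b G) z = entire_eval v G (a * z + b)"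
    and mu_entire_comp_le: "0 < R \<Longrightarrow> 0 < S \<Longrightarrow> v b \<le> S \<Longrightarrow> v a * R \<le> S \<Longrightarrow>
      mu_entire v R (entire_comp v a b G) \<le> mu_entire v S G"
  using ex_entire_comp[OF assms, of a b] entire_comp_eqI[of _ G a b] by auto

lemma entire_comp_add:
  "entire v G \<Longrightarrow> entire v H \<Longrightarrow> entire_comp v a b (G + H) = entire_comp v a b G + entire_comp v a b H"
  by (rule entire_comp_eqI) (auto simp: entire_intros entire_entire_comp ev_add ev_entire_comp)

lemma entire_comp_mult:
  "entire v G \<Longrightarrow> entire v H \<Longrightarrow> entire_comp v a b (G * H) = entire_comp v a b G * entire_comp v a b H"
  by (rule entire_comp_eqI) (auto simp: entire_intros entire_entire_comp ev_mult ev_entire_comp)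

lemma entire_comp_poly: "entire_comp v a b (fps_of_poly p) = fps_of_poly (pcompose p [:b, a:])"
  by (rule entire_comp_eqI) (auto simp: poly_pcompose add.commute mult.commute)

lemma entire_comp_const [simp]: "entire_comp v a b (fps_const c) = fps_const c"
  by (rule entire_comp_eqI) auto

lemma entire_comp_0 [simp]: "entire_comp v a b 0 = 0" using entire_comp_const[of a b 0] by simp
lemma entire_comp_1 [simp]: "entire_comp v a b 1 = 1" using entire_comp_const[of a b 1] by simp

lemma entire_comp_inverse:
  assumes "entire v G" "a \<noteq> 0"
  shows "entire_comp v (inverse a) (- b / a) (entire_comp v a b G) = G"
  using assms by (intro entire_comp_eqI) (auto simp: entire_entire_comp ev_entire_comp field_simps)

lemma entire_comp_eq_0_iff:
  assumes "entire v G" "a \<noteq> 0" shows "entire_comp v a b G = 0 \<longleftrightarrow> G = 0"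
  using entire_comp_inverse[OF assms, of b] by (metis entire_comp_0)

text \<open>The inverse map has constant term -b / a, of absolute value |b|, and leading coefficient
  of absolute value 1, so \<open>mu_entire_comp_le\<close> applies in both directions.\<close>

lemma mu_entire_comp:
  assumes G: "entire v G" and a: "v a = 1" and r: "0 < r" "v b \<le> r"
  shows "mu_entire v r (entire_comp v a b G) = mu_entire v r G"
proof (rule antisym)
  have a0: "a \<noteq> 0" using a by auto
  show "mu_entire v r (entire_comp v a b G) \<le> mu_entire v r G"
    using mu_entire_comp_le[OF G r(1) r(1,2)] a by simp
  have "mu_entire v r (entire_comp v (inverse a) (- b / a) (entire_comp v a b G)) \<le> mu_entire v r (entire_comp v a b G)"
    using mu_entire_comp_le[OF entire_entire_comp[OF G] r(1) r(1), of "- b / a" "inverse a"] a r by simp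
  then show "mu_entire v r G \<le> mu_entire v r (entire_comp v a b G)"
    using entire_comp_inverse[OF G a0] by simp
qed

subsection \<open>Meromorphic functions\<close>

lemma fls_divide_eq_iff:
  fixes G H G' H' :: "'a fps"
  assumes "H \<noteq> 0" "H' \<noteq> 0"
  shows "fps_to_fls G / fps_to_fls H = fps_to_fls G' / fps_to_fls H' \<longleftrightarrow> G * H' = G' * H"
  using assms by (simp add: frac_eq_eq fls_times_fps_to_fls[symmetric])

lemma mero_cases:
  assumes "F \<in> mero v"
  obtains G H where "entire v G" "entire v H" "H \<noteq> 0" "F = fps_to_fls G / fps_to_fls H"
  using assms unfolding mero_def by blast

lemma mero_intro: "entire v G \<Longrightarrow> entire v H \<Longrightarrow> H \<noteq> 0 \<Longrightarrow> fps_to_fls G / fps_to_fls H \<in> mero v"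
  unfolding mero_def by blast

text \<open>Independence of the chosen fraction: substitution respects the cross-multiplied identity
  and keeps nonzero denominators nonzero.\<close>

lemma mero_comp_eq:
  assumes "entire v G" "entire v H" "H \<noteq> 0" "a \<noteq> 0"
  shows "mero_comp v a b (fps_to_fls G / fps_to_fls H) =
    fps_to_fls (entire_comp v a b G) / fps_to_fls (entire_comp v a b H)"
  unfolding mero_comp_def
proof (rule the_equality)
  fix R
  assume "\<exists>G' H'. entire v G' \<and> entire v H' \<and> H' \<noteq> 0 \<and>
    fps_to_fls G / fps_to_fls H = fps_to_fls G' / fps_to_fls H' \<and>
    R = fps_to_fls (entire_comp v a b G') / fps_to_fls (entire_comp v a b H')"
  then obtain G' H' where *: "entire v G'" "entire v H'" "H' \<noteq> 0" "G * H' = G' * H"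
    and R: "R = fps_to_fls (entire_comp v a b G') / fps_to_fls (entire_comp v a b H')"
    using fls_divide_eq_iff assms by metis
  from *(4) have "entire_comp v a b G * entire_comp v a b H' = entire_comp v a b G' * entire_comp v a b H"
    using * assms by (metis entire_comp_mult)
  then show "R = fps_to_fls (entire_comp v a b G) / fps_to_fls (entire_comp v a b H)"
    unfolding R using * assms by (subst fls_divide_eq_iff) (auto simp: entire_comp_eq_0_iff)
qed (use assms in blast)

lemma mu_mero_eq:
  assumes "entire v G" "entire v H" "H \<noteq> 0" "0 < r"
  shows "mu_mero v r (fps_to_fls G / fps_to_fls H) = mu_entire v r G / mu_entire v r H"
  unfolding mu_mero_def
proof (rule the_equality)
  fix x
  assume "\<exists>G' H'. entire v G' \<and> entire v H' \<and> H' \<noteq> 0 \<and>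
    fps_to_fls G / fps_to_fls H = fps_to_fls G' / fps_to_fls H' \<and>
    x = mu_entire v r G' / mu_entire v r H'"
  then obtain G' H' where *: "entire v G'" "entire v H'" "H' \<noteq> 0" "G * H' = G' * H"
    and x: "x = mu_entire v r G' / mu_entire v r H'"
    using fls_divide_eq_iff assms by metis
  from *(4) have "mu_entire v r G * mu_entire v r H' = mu_entire v r G' * mu_entire v r H"
    using * assms by (metis mu_mult)
  then show "x = mu_entire v r G / mu_entire v r H"
    unfolding x using mu_pos[of H r] mu_pos[of H' r] * assms by (simp add: field_simps)
qed (use assms in blast)

lemma mero_add:
  assumes "F \<in> mero v" "F' \<in> mero v" shows "F + F' \<in> mero v"
proof -
  obtain G H where 1: "entire v G" "entire v H" "H \<noteq> 0" "F = fps_to_fls G / fps_to_fls H"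
    using mero_cases[OF assms(1)] by blast
  obtain G' H' where 2: "entire v G'" "entire v H'" "H' \<noteq> 0" "F' = fps_to_fls G' / fps_to_fls H'"
    using mero_cases[OF assms(2)] by blast
  have eq: "F + F' = fps_to_fls (G * H' + G' * H) / fps_to_fls (H * H')"
    using 1 2 by (simp add: add_frac_eq fls_times_fps_to_fls)
  show ?thesis unfolding eq by (rule mero_intro) (use 1 2 in \<open>auto simp: entire_intros\<close>)
qed

lemma mero_mult:
  assumes "F \<in> mero v" "F' \<in> mero v" shows "F * F' \<in> mero v"
proof -
  obtain G H where 1: "entire v G" "entire v H" "H \<noteq> 0" "F = fps_to_fls G / fps_to_fls H"
    using mero_cases[OF assms(1)] by blast
  obtain G' H' where 2: "entire v G'" "entire v H'" "H' \<noteq> 0" "F' = fps_to_fls G' / fps_to_fls H'"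
    using mero_cases[OF assms(2)] by blast
  have "F * F' = fps_to_fls (G * G') / fps_to_fls (H * H')"
    using 1 2 by (simp add: fls_times_fps_to_fls)
  then show ?thesis using 1 2 by (auto intro!: mero_intro entire_intros)
qed

lemma mero_const: "fls_const c \<in> mero v"
  using mero_intro[of "fps_const c" 1] by simp

lemma mero_0: "0 \<in> mero v" and mero_1: "1 \<in> mero v"
  using mero_const[of 0] mero_const[of 1] by simp_all

lemma mero_uminus: "F \<in> mero v \<Longrightarrow> - F \<in> mero v"
  using mero_mult[OF mero_const[of "-1"], of F] by simp

lemma mero_diff: "F \<in> mero v \<Longrightarrow> F' \<in> mero v \<Longrightarrow> F - F' \<in> mero v"
  using mero_add[OF _ mero_uminus, of F F'] by simp

lemma mero_power: "F \<in> mero v \<Longrightarrow> F ^ n \<in> mero v"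
  by (induction n) (auto intro: mero_mult mero_1)

lemma mero_sum: "(\<And>x. x \<in> A \<Longrightarrow> f x \<in> mero v) \<Longrightarrow> sum f A \<in> mero v"
  by (induction A rule: infinite_finite_induct) (auto intro: mero_add mero_0)

lemma mero_prod: "(\<And>x. x \<in> A \<Longrightarrow> f x \<in> mero v) \<Longrightarrow> prod f A \<in> mero v"
  by (induction A rule: infinite_finite_induct) (auto intro: mero_mult mero_1)

lemma mero_mero_comp:
  assumes "F \<in> mero v" "a \<noteq> 0" shows "mero_comp v a b F \<in> mero v"
  using assms(1)
  by (rule mero_cases)
    (use assms(2) in \<open>auto simp: mero_comp_eq entire_entire_comp entire_comp_eq_0_iff intro!: mero_intro\<close>)

lemma mero_comp_add:
  assumes "F \<in> mero v" "F' \<in> mero v" "a \<noteq> 0"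
  shows "mero_comp v a b (F + F') = mero_comp v a b F + mero_comp v a b F'"
proof -
  obtain G H where 1: "entire v G" "entire v H" "H \<noteq> 0" "F = fps_to_fls G / fps_to_fls H"
    using mero_cases[OF assms(1)] by blast
  obtain G' H' where 2: "entire v G'" "entire v H'" "H' \<noteq> 0" "F' = fps_to_fls G' / fps_to_fls H'"
    using mero_cases[OF assms(2)] by blast
  have "F + F' = fps_to_fls (G * H' + G' * H) / fps_to_fls (H * H')"
    using 1 2 by (simp add: add_frac_eq fls_times_fps_to_fls)
  also have "mero_comp v a b \<dots> = fps_to_fls (entire_comp v a b (G * H' + G' * H)) / fps_to_fls (entire_comp v a b (H * H'))"
    using 1 2 assms(3) by (intro mero_comp_eq) (auto simp: entire_intros)
  also have "\<dots> = mero_comp v a b F + mero_comp v a b F'"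
    using 1 2 assms(3)
    by (simp add: mero_comp_eq entire_comp_add entire_comp_mult entire_intros entire_comp_eq_0_iff
        add_frac_eq fls_times_fps_to_fls)
  finally show ?thesis .
qed

lemma mu_mero_nonneg: "F \<in> mero v \<Longrightarrow> 0 < r \<Longrightarrow> 0 \<le> mu_mero v r F"
  by (erule mero_cases) (simp add: mu_mero_eq mu_nonneg)

lemma mu_mero_pos:
  assumes "F \<in> mero v" "0 < r" "F \<noteq> 0" shows "0 < mu_mero v r F"
  using assms(1) by (rule mero_cases) (use assms(2,3) in \<open>auto simp: mu_mero_eq mu_pos\<close>)

lemma mu_mero_const [simp]: "0 < r \<Longrightarrow> mu_mero v r (fls_const c) = v c"
  using mu_mero_eq[of "fps_const c" 1 r] by simp

lemma mu_mero_0 [simp]: "0 < r \<Longrightarrow> mu_mero v r 0 = 0"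
  and mu_mero_1 [simp]: "0 < r \<Longrightarrow> mu_mero v r 1 = 1"
  using mu_mero_const[of r 0] mu_mero_const[of r 1] by simp_all

lemma mu_mero_mult:
  assumes "F \<in> mero v" "F' \<in> mero v" "0 < r"
  shows "mu_mero v r (F * F') = mu_mero v r F * mu_mero v r F'"
proof -
  obtain G H where 1: "entire v G" "entire v H" "H \<noteq> 0" "F = fps_to_fls G / fps_to_fls H"
    using mero_cases[OF assms(1)] by blast
  obtain G' H' where 2: "entire v G'" "entire v H'" "H' \<noteq> 0" "F' = fps_to_fls G' / fps_to_fls H'"
    using mero_cases[OF assms(2)] by blast
  have "F * F' = fps_to_fls (G * G') / fps_to_fls (H * H')"
    using 1 2 by (simp add: fls_times_fps_to_fls)
  also have "mu_mero v r \<dots> = mu_entire v r (G * G') / mu_entire v r (H * H')"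
    using 1 2 assms(3) by (intro mu_mero_eq) (auto simp: entire_intros)
  also have "\<dots> = mu_mero v r F * mu_mero v r F'" using 1 2 assms(3) by (simp add: mu_mult mu_mero_eq)
  finally show ?thesis .
qed

lemma mu_mero_uminus: "F \<in> mero v \<Longrightarrow> 0 < r \<Longrightarrow> mu_mero v r (- F) = mu_mero v r F"
  using mu_mero_mult[OF mero_const[of "-1"], of F r] mu_mero_const[of r "-1"] by simp

lemma mu_mero_add_le:
  assumes "F \<in> mero v" "F' \<in> mero v" "0 < r" "mu_mero v r F \<le> B" "mu_mero v r F' \<le> B"
  shows "mu_mero v r (F + F') \<le> B"
proof -
  obtain G H where 1: "entire v G" "entire v H" "H \<noteq> 0" "F = fps_to_fls G / fps_to_fls H"
    using mero_cases[OF assms(1)] by blast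
  obtain G' H' where 2: "entire v G'" "entire v H'" "H' \<noteq> 0" "F' = fps_to_fls G' / fps_to_fls H'"
    using mero_cases[OF assms(2)] by blast
  have p: "0 < mu_entire v r H" "0 < mu_entire v r H'" using 1 2 assms(3) mu_pos by auto
  have "F + F' = fps_to_fls (G * H' + G' * H) / fps_to_fls (H * H')"
    using 1 2 by (simp add: add_frac_eq fls_times_fps_to_fls)
  also have "mu_mero v r \<dots> = mu_entire v r (G * H' + G' * H) / mu_entire v r (H * H')"
    using 1 2 assms(3) by (intro mu_mero_eq) (auto simp: entire_intros)
  also have "\<dots> \<le> B * (mu_entire v r H * mu_entire v r H') / mu_entire v r (H * H')"
  proof (intro divide_right_mono mu_add_le)
    have "mu_entire v r G \<le> B * mu_entire v r H" "mu_entire v r G' \<le> B * mu_entire v r H'"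
      using assms(3,4,5) 1 2 p by (auto simp: mu_mero_eq pos_divide_le_eq)
    then show "mu_entire v r (G * H') \<le> B * (mu_entire v r H * mu_entire v r H')"
        "mu_entire v r (G' * H) \<le> B * (mu_entire v r H * mu_entire v r H')"
      using 1 2 assms(3) p by (auto simp: mu_mult mult.assoc[symmetric] mult.commute[of B] mult.left_commute)
  qed (use 1 2 assms(3) p in \<open>auto simp: entire_intros mu_mult\<close>)
  also have "\<dots> = B" using 1 2 p assms(3) by (simp add: mu_mult)
  finally show ?thesis .
qed

lemma mu_mero_diff_le:
  "F \<in> mero v \<Longrightarrow> F' \<in> mero v \<Longrightarrow> 0 < r \<Longrightarrow> mu_mero v r F \<le> B \<Longrightarrow> mu_mero v r F' \<le> B \<Longrightarrow>
    mu_mero v r (F - F') \<le> B"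
  using mu_mero_add_le[OF _ mero_uminus, of F F' r B] by (simp add: mu_mero_uminus)

lemma mu_mero_sum_le:
  assumes "\<And>x. x \<in> A \<Longrightarrow> f x \<in> mero v" "\<And>x. x \<in> A \<Longrightarrow> mu_mero v r (f x) \<le> B" "0 < r" "0 \<le> B"
  shows "mu_mero v r (sum f A) \<le> B"
  using assms
  by (induction A rule: infinite_finite_induct) (auto intro!: mu_mero_add_le mero_sum)

lemma mu_mero_comp:
  assumes "F \<in> mero v" "v a = 1" "0 < r" "v b \<le> r"
  shows "mu_mero v r (mero_comp v a b F) = mu_mero v r F"
proof -
  have "a \<noteq> 0" using assms by auto
  then show ?thesis using assms(1)
    by (elim mero_cases) (use assms(2-) in \<open>simp add: mero_comp_eq mu_mero_eq entire_entire_comp entire_comp_eq_0_iff mu_entire_comp\<close>)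
qed

lemma mu_mero_inverse:
  assumes "F \<in> mero v" "0 < r"
  shows "mu_mero v r (1 / F) = 1 / mu_mero v r F"
proof (cases "F = 0")
  case False
  obtain G H where 1: "entire v G" "entire v H" "H \<noteq> 0" "F = fps_to_fls G / fps_to_fls H"
    using mero_cases[OF assms(1)] by blast
  then have "G \<noteq> 0" using False by auto
  moreover have "1 / F = fps_to_fls H / fps_to_fls G" using 1 by simp
  ultimately show ?thesis using 1 assms(2) by (simp add: mu_mero_eq)
qed (use assms in simp)

subsection \<open>Existence of zeros\<close>

text \<open>The factors equal 1 at 0, so the constant coefficient splits off and the Gauss norm
  divided by its absolute value is a product over the roots.\<close>

lemma poly_root_factorization:
  fixes p :: "'a poly"
  assumes "coeff p 0 \<noteq> 0"
  shows "\<exists>W. 0 \<notin># W \<and> p = [:coeff p 0:] * (\<Prod>w\<in>#W. [:1, - inverse w:])"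
  using assms
proof (induction "degree p" arbitrary: p)
  case 0
  then obtain c where "p = [:c:]" by (metis degree_eq_zeroE)
  then show ?case by (intro exI[of _ "{#}"]) simp
next
  case (Suc n)
  then obtain w where w: "poly p w = 0" using closed unfolding alg_closed_def by (metis zero_less_Suc)
  then obtain q where q: "p = [:-w, 1:] * q" by (metis dvdE poly_eq_0_iff_dvd)
  have w0: "w \<noteq> 0" using w Suc.prems by (auto simp: poly_0_coeff_0)
  define q' where "q' = smult (- w) q"
  have p: "p = [:1, - inverse w:] * q'" unfolding q q'_def using w0 by (simp add: field_simps)
  have "p \<noteq> 0" using Suc.prems by auto
  then have "q' \<noteq> 0" using p by auto
  then have "degree p = Suc (degree q')" unfolding p using w0 by (subst degree_mult_eq) auto
  moreover have c: "coeff q' 0 = coeff p 0" unfolding p by (simp add: mult_poly_0_left coeff_mult)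
  ultimately obtain W where W: "0 \<notin># W" "q' = [:coeff q' 0:] * (\<Prod>w\<in>#W. [:1, - inverse w:])"
    using Suc.hyps(1)[of q'] Suc.hyps(2) Suc.prems by auto
  have "p = [:1, - inverse w:] * ([:coeff p 0:] * (\<Prod>w\<in>#W. [:1, - inverse w:]))"
    using p W(2) c by metis
  then have "p = [:coeff p 0:] * (\<Prod>w\<in>#add_mset w W. [:1, - inverse w:])" by (simp add: mult_ac)
  then show ?case using W w0 by (intro exI[of _ "add_mset w W"]) auto
qed

lemma poly_root_factorization_root:
  assumes "0 \<notin># W" "w \<in># W"
  shows "poly ([:c:] * (\<Prod>w\<in>#W. [:1, - inverse w:])) w = (0 :: 'a)"
proof -
  obtain M where "W = add_mset w M" using assms(2) by (metis multi_member_split)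
  then show ?thesis using assms(1) by auto
qed

lemma fps_of_poly_prod_mset: "fps_of_poly (\<Prod>x\<in>#M. f x) = (\<Prod>x\<in>#M. fps_of_poly (f x))"
  by (induction M) (auto simp: fps_of_poly_mult)

lemma mu_root_factorization:
  assumes "0 < R" "0 \<notin># W"
  shows "mu_entire v R (fps_of_poly ([:c:] * (\<Prod>w\<in>#W. [:1, - inverse w:])))
    = v c * (\<Prod>w\<in>#W. max 1 (R / v w))"
proof -
  have "(\<Prod>w\<in>#W. mu_entire v R (fps_of_poly [:1, - inverse w:])) = (\<Prod>w\<in>#W. max 1 (R / v w))"
    using assms by (intro arg_cong[where f = prod_mset] image_mset_cong) (auto simp: mu_linear divide_simps)
  then show ?thesis using assms unfolding fps_of_poly_mult fps_of_poly_prod_mset fps_of_poly_const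
    by (simp add: mu_mult mu_prod_mset entire_prod_mset del: fps_of_poly_linear)
qed

lemma power_size_le_prod_mset:
  fixes f :: "'b \<Rightarrow> real"
  assumes "\<And>x. x \<in># M \<Longrightarrow> b \<le> f x" "0 \<le> b"
  shows "b ^ size M \<le> (\<Prod>x\<in>#M. f x)"
  using assms by (induction M) (auto intro!: mult_mono intro: order_trans)

text \<open>The bound depends on the polynomial only through the number of its roots in the disc,
  so it is uniform over the truncations of a power series.\<close>

lemma near_root:
  fixes p :: "'a poly"
  assumes c0: "coeff p 0 \<noteq> 0" and R: "0 < R" and z: "v z \<le> R" and small: "v (poly p z) < v (coeff p 0)"
    and d: "mu_entire v (2 * R) (fps_of_poly p) \<le> v (coeff p 0) * 2 ^ d"
  shows "\<exists>w. poly p w = 0 \<and> v w \<le> R \<and> v (coeff p 0) * (v (w - z) / R) ^ d \<le> v (poly p z)"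
proof -
  obtain W where W: "0 \<notin># W" "p = [:coeff p 0:] * (\<Prod>w\<in>#W. [:1, - inverse w:])"
    using poly_root_factorization[OF c0] by blast
  define M where "M = filter_mset (\<lambda>w. v w \<le> R) W"
  define M' where "M' = filter_mset (\<lambda>w. \<not> v w \<le> R) W"
  have WM: "W = M + M'" unfolding M_def M'_def by (rule multiset_partition)
  have cpos: "0 < v (coeff p 0)" using c0 by (rule v_pos)
  \<comment> \<open>At radius 2R each root in the disc contributes a factor of at least 2 to the
    norm and every other root at least 1, so d bounds their number.\<close>
  have size: "size M \<le> d"
  proof -
    have "2 ^ size M \<le> (\<Prod>w\<in>#M. max 1 (2 * R / v w))"
    proof (rule power_size_le_prod_mset)
      fix w assume w: "w \<in># M"
      then have "w \<noteq> 0" "v w \<le> R" using W(1) by (auto simp: M_def)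
      then show "2 \<le> max 1 (2 * R / v w)" by (simp add: le_max_iff_disj pos_le_divide_eq v_pos)
    qed simp
    also have "\<dots> \<le> (\<Prod>w\<in>#M. max 1 (2 * R / v w)) * (\<Prod>w\<in>#M'. max 1 (2 * R / v w))"
    proof -
      have "1 \<le> (\<Prod>w\<in>#M'. max 1 (2 * R / v w))"
        using power_size_le_prod_mset[of M' 1 "\<lambda>w. max 1 (2 * R / v w)"] by simp
      moreover have "0 \<le> (\<Prod>w\<in>#M. max 1 (2 * R / v w))"
        by (induction M) (auto simp: le_max_iff_disj)
      ultimately show ?thesis using mult_left_mono by fastforce
    qed
    finally have "2 ^ size M \<le> (\<Prod>w\<in>#W. max 1 (2 * R / v w))" by (simp add: WM)
    then have "v (coeff p 0) * 2 ^ size M \<le> mu_entire v (2 * R) (fps_of_poly p)"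
      using R W(1) cpos by (subst W(2), subst mu_root_factorization) auto
    then have "v (coeff p 0) * 2 ^ size M \<le> v (coeff p 0) * 2 ^ d" using d by linarith
    then have "(2::real) ^ size M \<le> 2 ^ d" using cpos by simp
    then show ?thesis by simp
  qed
  \<comment> \<open>Here |z| < |w|, so the term 1 dominates: roots outside the disc do not affect
    the size of the value at z.\<close>
  have far: "v (1 - z / w) = 1" if "w \<in># M'" for w
  proof -
    have "v z < v w" using that z by (auto simp: M'_def)
    then have "v (- (z / w)) < v 1" using order_le_less_trans[OF v_nonneg] by simp
    from v_add_eq[OF this] show ?thesis by simp
  qed
  have val: "v (poly p z) = v (coeff p 0) * (\<Prod>w\<in>#M. v (1 - z / w))"
  proof -
    have "v (poly p z) = v (coeff p 0) * (\<Prod>w\<in>#W. v (1 - z / w))"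
      by (subst W(2)) (simp add: poly_prod_mset v_prod_mset image_mset.compositionality o_def divide_inverse)
    also have "(\<Prod>w\<in>#M'. v (1 - z / w)) = (\<Prod>w\<in>#M'. 1)"
      by (intro arg_cong[where f = prod_mset] image_mset_cong far)
    then have "(\<Prod>w\<in>#W. v (1 - z / w)) = (\<Prod>w\<in>#M. v (1 - z / w))" by (simp add: WM)
    finally show ?thesis .
  qed
  have "M \<noteq> {#}" using val small by auto
  \<comment> \<open>The root in the disc nearest to z is chosen. Each of the at most d factors is at
    least its distance to z divided by R; this ratio is at most 1, so the exponent may be raised to
    d.\<close>
  define D where "D = (\<lambda>w. v (w - z) / R) ` set_mset M"
  have "Min D \<in> D" using \<open>M \<noteq> {#}\<close> unfolding D_def by (intro Min_in) auto
  then obtain w where w: "w \<in># M" "Min D = v (w - z) / R" unfolding D_def by auto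
  have wR: "v w \<le> R" and wW: "w \<in># W" using w(1) by (auto simp: M_def)
  have d1: "v (w - z) / R \<le> 1" using v_diff_le[OF wR z] R by simp
  have "(v (w - z) / R) ^ size M \<le> (\<Prod>w\<in>#M. v (1 - z / w))"
  proof (rule power_size_le_prod_mset)
    fix x assume x: "x \<in># M"
    then have x0: "x \<noteq> 0" "v x \<le> R" using W(1) by (auto simp: M_def)
    have "v (w - z) / R \<le> v (x - z) / R" using w(2) x unfolding D_def by (metis Min_le finite_imageI finite_set_mset imageI)
    also have "\<dots> \<le> v (x - z) / v x" using x0 by (intro divide_left_mono) (auto simp: v_pos R)
    also have "\<dots> = v (1 - z / x)" using x0 by (simp add: v_divide[symmetric] diff_divide_distrib del: v_divide)
    finally show "v (w - z) / R \<le> v (1 - z / x)" .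
  qed (use R in simp)
  moreover have "(v (w - z) / R) ^ d \<le> (v (w - z) / R) ^ size M"
    using size d1 R by (intro power_decreasing) auto
  ultimately have "v (coeff p 0) * (v (w - z) / R) ^ d \<le> v (poly p z)"
    using val cpos by (simp add: order_trans)
  moreover have "poly p w = 0" using poly_root_factorization_root[OF W(1) wW] W(2) by metis
  ultimately show ?thesis using wR by blast
qed

text \<open>Since |w| <= R, the factor X - w has norm exactly R, so dividing it out divides the norm
  by R.\<close>

lemma poly_root_bound:
  fixes p :: "'a poly"
  assumes "poly p w = 0" "0 < R" "v w \<le> R" "v z \<le> R"
  shows "v (poly p z) \<le> v (z - w) * mu_entire v R (fps_of_poly p) / R"
proof -
  obtain q where q: "p = [:-w, 1:] * q" using assms(1) by (metis dvdE poly_eq_0_iff_dvd)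
  have "mu_entire v R (fps_of_poly p) = R * mu_entire v R (fps_of_poly q)"
    using assms unfolding q fps_of_poly_mult by (simp add: mu_mult mu_linear max_absorb2 del: fps_of_poly_linear)
  moreover have "v (poly p z) = v (z - w) * v (poly q z)" unfolding q by (simp flip: v_mult) (simp add: algebra_simps)
  moreover have "v (poly q z) \<le> mu_entire v R (fps_of_poly q)"
    using ev_bound[of "fps_of_poly q" R z] assms by simp
  ultimately show ?thesis using assms(2) by (simp add: mult_left_mono)
qed

text \<open>The roots of the truncations can be chosen to form a Cauchy sequence.\<close>

lemma ex_zero_in_disc:
  assumes U: "entire v U" and u0: "fps_nth U 0 \<noteq> 0" and R: "0 < R" and big: "v (fps_nth U 0) < mu_entire v R U"
  shows "\<exists>z. v z \<le> R \<and> entire_eval v U z = 0"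
proof -
  let ?u = "v (fps_nth U 0)"
  define p where "p N = trunc (Suc N) U" for N
  have cpos: "0 < ?u" using u0 by (rule v_pos)
  have c0: "coeff (p N) 0 = fps_nth U 0" for N by (simp add: p_def coeff_trunc)
  \<comment> \<open>One d serves all truncations, since truncating does not increase the
    norm.\<close>
  obtain d where d: "mu_entire v (2 * R) U / ?u < 2 ^ d" using real_arch_pow[of 2] by auto
  have dN: "mu_entire v (2 * R) (fps_of_poly (p N)) \<le> v (coeff (p N) 0) * 2 ^ d" for N
    using mu_trunc_le[OF U, of "2 * R" "Suc N"] R d cpos unfolding c0 by (simp add: pos_divide_less_eq p_def mult.commute)
  obtain k where k: "v (fps_nth U k) * R ^ k = mu_entire v R U" using mu_attained_first[OF U R] by blast
  obtain N1 where N1: "\<forall>n\<ge>N1. v (fps_nth U n) * R ^ n < ?u" using entire_eventually_less[OF U R cpos] by blast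
  \<comment> \<open>Including the index k keeps the norm of \<open>p N0\<close> above |U(0)|, which
    yields a first root in the disc; past N1 every further term is below |U(0)| there, as
    \<open>near_root\<close> requires.\<close>
  define N0 where "N0 = max k N1"
  have "\<exists>w. poly (p N0) w = 0 \<and> v w \<le> R"
  proof -
    obtain W where W: "0 \<notin># W" "p N0 = [:coeff (p N0) 0:] * (\<Prod>w\<in>#W. [:1, - inverse w:])"
      using poly_root_factorization[of "p N0"] u0 c0 by metis
    have "mu_entire v R U \<le> mu_entire v R (fps_of_poly (p N0))"
      using mu_ge[of "fps_of_poly (p N0)" R k] R k by (simp add: p_def coeff_trunc N0_def less_Suc_eq_le)
    also have "\<dots> = ?u * (\<Prod>w\<in>#W. max 1 (R / v w))"
      using mu_root_factorization[OF R W(1), of "coeff (p N0) 0"] unfolding W(2)[symmetric] unfolding c0 .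
    finally have gt: "?u < ?u * (\<Prod>w\<in>#W. max 1 (R / v w))" using big by linarith
    have "\<exists>w\<in>#W. v w \<le> R"
    proof (rule ccontr)
      assume "\<not> ?thesis"
      then have "max 1 (R / v w) = 1" if "w \<in># W" for w
        using that R by (auto simp: max_def pos_le_divide_eq)
      then have "(\<Prod>w\<in>#W. max 1 (R / v w)) = (\<Prod>w\<in>#W. 1)"
        by (intro arg_cong[where f = prod_mset] image_mset_cong)
      then show False using gt by simp
    qed
    then obtain w where w: "w \<in># W" "v w \<le> R" by blast
    then have "poly (p N0) w = 0" using poly_root_factorization_root[OF W(1)] W(2) by metis
    then show ?thesis using w by blast
  qed
  then have "\<exists>x. poly (p (N0 + 0)) x = 0 \<and> v x \<le> R" by simp
  \<comment> \<open>The next truncation adds one monomial, so its value at the old root is just that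
    term, small enough to produce a nearby new root.\<close>
  moreover have "\<exists>y. (poly (p (N0 + Suc n)) y = 0 \<and> v y \<le> R) \<and>
      ?u * (v (y - x) / R) ^ d \<le> v (fps_nth U (N0 + Suc n)) * R ^ (N0 + Suc n)"
    if x: "poly (p (N0 + n)) x = 0 \<and> v x \<le> R" for x n
  proof -
    let ?N = "N0 + Suc n"
    have "p ?N = p (N0 + n) + monom (fps_nth U ?N) ?N" by (simp add: p_def trunc_def)
    then have "poly (p ?N) x = fps_nth U ?N * x ^ ?N" using x by (simp add: poly_monom)
    then have val: "v (poly (p ?N) x) \<le> v (fps_nth U ?N) * R ^ ?N"
      using x by (simp del: power_Suc add: mult_left_mono power_mono)
    also have "\<dots> < ?u" using N1[rule_format, of ?N] unfolding N0_def by linarith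
    finally have "v (poly (p ?N) x) < v (coeff (p ?N) 0)" by (simp add: c0)
    from near_root[OF _ R _ this dN] u0 x obtain y where
      "poly (p ?N) y = 0" "v y \<le> R" "?u * (v (y - x) / R) ^ d \<le> v (poly (p ?N) x)"
      by (auto simp: c0)
    then show ?thesis using val by (intro exI[of _ y]) auto
  qed
  ultimately have "\<exists>x. \<forall>n. (poly (p (N0 + n)) (x n) = 0 \<and> v (x n) \<le> R) \<and>
      ?u * (v (x (Suc n) - x n) / R) ^ d \<le> v (fps_nth U (N0 + Suc n)) * R ^ (N0 + Suc n)"
    by (rule dependent_nat_choice)
  then obtain x where x: "\<And>n. poly (p (N0 + n)) (x n) = 0" "\<And>n. v (x n) \<le> R"
    and step: "\<And>n. ?u * (v (x (Suc n) - x n) / R) ^ d \<le> v (fps_nth U (N0 + Suc n)) * R ^ (N0 + Suc n)"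
    by blast
  have "(\<lambda>n. v (x (Suc n) - x n)) \<longlonglongrightarrow> 0"
  proof (rule order_tendstoI)
    fix e :: real assume e: "0 < e"
    then obtain N where N: "\<forall>n\<ge>N. v (fps_nth U n) * R ^ n < ?u * (e / R) ^ d"
      using entire_eventually_less[OF U R, of "?u * (e / R) ^ d"] cpos R by auto
    have "v (x (Suc n) - x n) < e" if "n \<ge> N" for n
    proof -
      have "?u * (v (x (Suc n) - x n) / R) ^ d < ?u * (e / R) ^ d"
        using step[of n] N[rule_format, of "N0 + Suc n"] that by linarith
      then have "(v (x (Suc n) - x n) / R) ^ d < (e / R) ^ d" using cpos by simp
      then have "v (x (Suc n) - x n) / R < e / R" by (rule power_less_imp_less_base) (use e R in simp)
      then show ?thesis using R by (simp add: divide_less_cancel)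
    qed
    then show "\<forall>\<^sub>F n in sequentially. v (x (Suc n) - x n) < e" by (auto simp: eventually_sequentially)
  qed (auto intro!: always_eventually less_le_trans[OF _ v_nonneg])
  then obtain z where z: "vlim x z" using vlim_exists by blast
  have zR: "v z \<le> R" using vlim_bound[OF z, of 0 R] x(2) by simp
  have "vlim (\<lambda>N. entire_eval v (fps_of_poly (trunc N U)) z) (entire_eval v U z)"
    by (rule ev_limit[OF U _ mu_trunc_tendsto[OF U R] R zR]) simp
  then have "vlim (\<lambda>n. poly (trunc n U) z) (entire_eval v U z)" by simp
  then have 1: "vlim (\<lambda>n. poly (p (N0 + n)) z) (entire_eval v U z)"
    unfolding vlim_def p_def by (rule LIMSEQ_subseq_LIMSEQ[where f = "\<lambda>n. Suc (N0 + n)", unfolded o_def]) (auto simp: strict_mono_def)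
  \<comment> \<open>The values at z vanish in the limit because the roots \<open>x n\<close>
    approach z while the truncations have uniformly bounded norm.\<close>
  have 2: "vlim (\<lambda>n. poly (p (N0 + n)) z) 0"
  proof (rule vlim_squeeze)
    have "v (poly (p (N0 + n)) z) \<le> v (x n - z) * (mu_entire v R U / R)" for n
    proof -
      have "v (poly (p (N0 + n)) z) \<le> v (z - x n) * mu_entire v R (fps_of_poly (p (N0 + n))) / R"
        using poly_root_bound[OF x(1) R x(2) zR] .
      also have "\<dots> \<le> v (z - x n) * mu_entire v R U / R"
        using mu_trunc_le[OF U R] R by (intro divide_right_mono mult_left_mono) (auto simp: p_def)
      finally show ?thesis by (simp add: v_minus_commute)
    qed
    then show "\<forall>\<^sub>F n in sequentially. v (poly (p (N0 + n)) z - 0) \<le> v (x n - z) * (mu_entire v R U / R)" by simp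
    have "(\<lambda>n. v (x n - z) * (mu_entire v R U / R)) \<longlonglongrightarrow> 0 * (mu_entire v R U / R)"
      using z unfolding vlim_def by (intro tendsto_mult tendsto_const)
    then show "(\<lambda>n. v (x n - z) * (mu_entire v R U / R)) \<longlonglongrightarrow> 0" by simp
  qed
  show ?thesis using vlim_unique[OF 1 2] zR by blast
qed

lemma mu_zero_free:
  assumes U: "entire v U" and R: "0 < r" "r \<le> R" and z: "\<And>z. v z \<le> R \<Longrightarrow> entire_eval v U z \<noteq> 0"
  shows "mu_entire v r U = v (fps_nth U 0)"
proof -
  have "fps_nth U 0 \<noteq> 0" using z[of 0] R ev_at_0[OF U] by simp
  then have "\<not> v (fps_nth U 0) < mu_entire v r U"
    using ex_zero_in_disc[OF U _ R(1)] z R(2) by (meson order_trans)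
  then show ?thesis using mu_ge[OF U R(1), of 0] by simp
qed

subsection \<open>Zeros and poles in a disc\<close>

text \<open>The lowest coefficient is 1 in both cases and stays 1 in products. The logarithm of the
  norm of each factor is the contribution of one pole to the counting function.\<close>

definition lin_poly :: "'a \<Rightarrow> 'a poly" where
  "lin_poly w = (if w = 0 then [:0, 1:] else [:1, - inverse w:])"

abbreviation lin :: "'a \<Rightarrow> 'a fps" where
  "lin w \<equiv> fps_of_poly (lin_poly w)"

text \<open>The order of vanishing at z, by the recentring also used in
  \<open>pole_ord\<close>.\<close>

definition zord :: "'a \<Rightarrow> 'a fps \<Rightarrow> nat" where
  "zord z G = subdegree (entire_comp v 1 z G)"

lemma lin_neq_0 [simp]: "lin w \<noteq> 0"
  by (simp add: lin_poly_def)

lemma mu_X: "0 < R \<Longrightarrow> mu_entire v R fps_X = R"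
  using mu_linear[of R 0 1] by (simp add: fps_of_poly_pCons)

lemma mu_lin: "0 < R \<Longrightarrow> mu_entire v R (lin w) = (if w = 0 then R else max 1 (R / v w))"
  by (simp add: lin_poly_def mu_linear mu_X divide_inverse mult.commute)

lemma subdegree_lin: "subdegree (lin w) = (if w = 0 then 1 else 0)"
  by (auto simp: lin_poly_def subdegree_eq_0_iff fps_of_poly_pCons)

lemma lead_lin: "coeff (lin_poly w) (subdegree (lin w)) = 1"
  unfolding subdegree_lin by (simp add: lin_poly_def)

lemma zord_lin: "zord z (lin w) = (if z = w then 1 else 0)"
proof (cases "z = w")
  case True
  have "pcompose (lin_poly w) [:w, 1:] = smult (if w = 0 then 1 else - inverse w) [:0, 1:]"
    by (simp add: lin_poly_def pcompose_pCons)
  then have "entire_comp v 1 z (lin w) = fps_const (if w = 0 then 1 else - inverse w) * fps_X"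
    using True by (simp add: entire_comp_poly fps_of_poly_smult fps_of_poly_pCons)
  then show ?thesis using True by (simp add: zord_def)
next
  case False
  have "fps_nth (entire_comp v 1 z (lin w)) 0 = poly (lin_poly w) z"
    by (simp add: entire_comp_poly poly_0_coeff_0[symmetric] poly_pcompose)
  moreover have "poly (lin_poly w) z \<noteq> 0" using False by (auto simp: lin_poly_def field_simps)
  ultimately show ?thesis using False by (simp add: zord_def subdegree_eq_0_iff)
qed

lemma zord_mult: "entire v G \<Longrightarrow> entire v H \<Longrightarrow> G \<noteq> 0 \<Longrightarrow> H \<noteq> 0 \<Longrightarrow> zord z (G * H) = zord z G + zord z H"
  by (simp add: zord_def entire_comp_mult entire_comp_eq_0_iff)

lemma zord_nonzero: "entire v U \<Longrightarrow> entire_eval v U z \<noteq> 0 \<Longrightarrow> zord z U = 0"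
  using ev_entire_comp[of U 1 z 0] ev_at_0[OF entire_entire_comp, of U 1 z]
  by (simp add: zord_def subdegree_eq_0_iff)

lemma entire_prod_lin [simp]: "entire v (\<Prod>w\<in>#W. lin w)"
  by (simp add: entire_prod_mset)

lemma zero_notin_lin_image [simp]: "0 \<notin> lin ` S"
  using lin_neq_0 by (metis imageE)

lemma prod_lin_neq_0 [simp]: "(\<Prod>w\<in>#W. lin w) \<noteq> 0"
  by simp

lemma zord_prod_lin: "zord z (\<Prod>w\<in>#W. lin w) = count W z"
proof (induction W)
  case empty
  then show ?case by (simp add: zord_def)
next
  case (add w W)
  then show ?case using zord_mult[of "lin w" "\<Prod>w\<in>#W. lin w" z] by (simp add: zord_lin)
qed

lemma subdegree_prod_lin: "subdegree (\<Prod>w\<in>#W. lin w) = count W 0"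
  by (induction W) (auto simp: subdegree_lin)

lemma lead_mult:
  fixes G H :: "'a fps"
  assumes "G \<noteq> 0" "H \<noteq> 0"
  shows "fps_nth (G * H) (subdegree (G * H)) = fps_nth G (subdegree G) * fps_nth H (subdegree H)"
  using assms by (simp add: nth_subdegree_mult)

lemma lead_prod_lin: "fps_nth (\<Prod>w\<in>#W. lin w) (subdegree (\<Prod>w\<in>#W. lin w)) = 1"
proof (induction W)
  case (add w W)
  then show ?case using lead_mult[of "lin w" "\<Prod>w\<in>#W. lin w"] by (simp add: lead_lin)
qed simp

text \<open>Recentred at w, a zero means divisibility by X; the inverse translation carries the
  factor back.\<close>

lemma lin_divides:
  assumes G: "entire v G" and z: "entire_eval v G w = 0"
  shows "\<exists>H. entire v H \<and> G = lin w * H"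
proof -
  define B where "B = entire_comp v 1 w G"
  define V where "V = entire_comp v 1 (- w) (fps_shift 1 B)"
  \<comment> \<open>The scalar relating the translated factor X - w to the normalised factor
    \<open>lin w\<close>.\<close>
  define c where "c = (if w = 0 then 1 else - w)"
  have EB: "entire v B" using G by (simp add: B_def entire_entire_comp)
  have EV: "entire v V" unfolding V_def by (intro entire_entire_comp entire_fps_shift EB)
  have "fps_nth B 0 = 0" using ev_at_0[OF EB] ev_entire_comp[OF G, of 1 w 0] z by (simp add: B_def)
  then have "B = fps_of_poly [:0, 1:] * fps_shift 1 B"
    using fps_split_const[of B] by (simp add: fps_of_poly_pCons)
  moreover have "G = entire_comp v 1 (- w) B" using entire_comp_inverse[OF G, of 1 w] by (simp add: B_def)
  ultimately have "G = entire_comp v 1 (- w) (fps_of_poly [:0, 1:]) * V"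
    unfolding V_def by (metis entire_comp_mult entire_poly entire_fps_shift[OF EB])
  then have "G = fps_of_poly [:- w, 1:] * V" by (simp only: entire_comp_poly) (simp add: pcompose_pCons)
  also have "[:- w, 1:] = lin_poly w * [:c:]" by (simp add: lin_poly_def c_def)
  finally have "G = lin w * (fps_const c * V)" by (simp only: fps_of_poly_mult fps_of_poly_const mult.assoc)
  then show ?thesis using entire_mult[OF entire_const EV] by blast
qed

text \<open>Dividing out \<open>lin w\<close> keeps the lowest coefficient and at least halves the
  norm at radius 2R. The quotient of this norm by the absolute value of that coefficient is at least
  1, since 2R >= 1, so the extraction of zeros terminates.\<close>

lemma entire_factorization:
  assumes "entire v G" "G \<noteq> 0" and R: "1 \<le> R"
  shows "\<exists>W U. entire v U \<and> G = (\<Prod>w\<in>#W. lin w) * U \<and> (\<forall>w\<in>#W. v w \<le> R) \<and>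
    (\<forall>z. v z \<le> R \<longrightarrow> entire_eval v U z \<noteq> 0)"
proof -
  obtain n where n: "mu_entire v (2 * R) G / v (fps_nth G (subdegree G)) < 2 ^ n"
    using real_arch_pow[of 2] by auto
  have "0 < v (fps_nth G (subdegree G))" using assms(2) by (simp add: v_pos)
  then have "mu_entire v (2 * R) G < 2 ^ n * v (fps_nth G (subdegree G))"
    using n by (simp add: pos_divide_less_eq)
  then show ?thesis using assms(1,2)
  proof (induction n arbitrary: G)
    case 0
    have "v (fps_nth G (subdegree G)) * 1 \<le> v (fps_nth G (subdegree G)) * (2 * R) ^ subdegree G"
      using R by (intro mult_left_mono one_le_power) auto
    also have "\<dots> \<le> mu_entire v (2 * R) G" using R 0 by (intro mu_ge) auto
    finally show ?case using 0 by simp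
  next
    case (Suc n)
    show ?case
    proof (cases "\<forall>z. v z \<le> R \<longrightarrow> entire_eval v G z \<noteq> 0")
      case True
      then show ?thesis using Suc.prems by (intro exI[of _ "{#}"] exI[of _ G]) auto
    next
      case False
      then obtain w where w: "v w \<le> R" "entire_eval v G w = 0" by blast
      obtain H where H: "entire v H" "G = lin w * H" using lin_divides[OF Suc.prems(2) w(2)] by blast
      have H0: "H \<noteq> 0" using H(2) Suc.prems(3) by auto
      have "2 * mu_entire v (2 * R) H \<le> mu_entire v (2 * R) (lin w) * mu_entire v (2 * R) H"
      proof (rule mult_right_mono)
        show "2 \<le> mu_entire v (2 * R) (lin w)"
          using R w(1) by (auto simp: mu_lin le_max_iff_disj pos_le_divide_eq v_pos)
      qed (use mu_nonneg H R in auto)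
      also have "\<dots> = mu_entire v (2 * R) G" using H R by (simp add: mu_mult)
      also have "\<dots> < 2 ^ Suc n * v (fps_nth G (subdegree G))" by (rule Suc.prems(1))
      also have "fps_nth G (subdegree G) = fps_nth H (subdegree H)"
        unfolding H(2) by (subst lead_mult[OF lin_neq_0 H0]) (simp add: lead_lin)
      finally have "mu_entire v (2 * R) H < 2 ^ n * v (fps_nth H (subdegree H))" by simp
      from Suc.IH[OF this H(1) H0] obtain W U where
        "entire v U" "H = (\<Prod>w\<in>#W. lin w) * U" "\<forall>w\<in>#W. v w \<le> R" "\<forall>z. v z \<le> R \<longrightarrow> entire_eval v U z \<noteq> 0"
        by blast
      then show ?thesis using H(2) w(1) by (intro exI[of _ "add_mset w W"] exI[of _ U]) (auto simp: mult.assoc)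
    qed
  qed
qed

section \<open>The counting function of finitely many poles\<close>

lemma has_integral_inverse_from:
  fixes a r :: real
  assumes "0 < a" "0 < r"
  shows "((\<lambda>t. if a \<le> t then 1 / t else 0) has_integral ln (max 1 (r / a))) {0..r}"
proof (cases "a \<le> r")
  case True
  have "((\<lambda>t. 1 / t) has_integral ln r - ln a) {a..r}"
    using True assms
    by (intro fundamental_theorem_of_calculus)
      (auto intro!: derivative_eq_intros simp: has_real_derivative_iff_has_vector_derivative[symmetric])
  then have "((\<lambda>t. if t \<in> {a..r} then 1 / t else 0) has_integral ln r - ln a) {0..r}"
    using assms by (subst has_integral_restrict) auto
  then have "((\<lambda>t. if a \<le> t then 1 / t else 0) has_integral ln r - ln a) {0..r}"
    by (rule has_integral_eq[rotated]) auto
  moreover have "ln r - ln a = ln (max 1 (r / a))" using True assms by (simp add: ln_div max_absorb2)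
  ultimately show ?thesis by simp
next
  case False
  then have "max 1 (r / a) = 1" using assms by (simp add: max_absorb1)
  moreover have "((\<lambda>t. if a \<le> t then 1 / t else 0) has_integral 0) {0..r}"
    using False by (intro has_integral_is_0) auto
  ultimately show ?thesis by simp
qed

text \<open>Poles away from 0 contribute through the integral and a pole at 0 through the term with
  ln r; by \<open>mu_lin\<close> both contributions are logarithms of norms of linear
  factors.\<close>

lemma count_fn_eq:
  assumes ord: "\<And>z. v z \<le> R \<Longrightarrow> pole_ord v F z = count D z" and D: "\<And>w. w \<in># D \<Longrightarrow> v w \<le> R"
    and r: "0 < r" "r \<le> R"
  shows "count_fn v r F = ln (\<Prod>w\<in>#D. mu_entire v r (lin w))"
proof -
  let ?S = "set_mset D - {0}"
  have pc: "pole_count v t F = (\<Sum>z | z \<in># D \<and> v z \<le> t. count D z)" if "t \<le> R" for t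
  proof -
    have "{z. v z \<le> t \<and> 0 < pole_ord v F z} = {z. z \<in># D \<and> v z \<le> t}"
      using ord that by (auto simp: count_greater_zero_iff)
    then show ?thesis unfolding pole_count_def using ord that by (intro sum.cong) auto
  qed
  have pc0: "pole_count v 0 F = count D 0"
  proof -
    have "v z \<le> 0 \<longleftrightarrow> z = 0" for z by (metis antisym order_refl v_eq_0 v_nonneg)
    then have "{z. z \<in># D \<and> v z \<le> 0} = (if 0 \<in># D then {0} else {})" by auto
    then show ?thesis using pc[of 0] r by (simp add: not_in_iff)
  qed
  have split: "real (pole_count v t F) - real (pole_count v 0 F)
      = (\<Sum>z\<in>?S. real (count D z) * (if v z \<le> t then 1 else 0))" if "0 \<le> t" "t \<le> R" for t
  proof -
    have "(\<Sum>z | z \<in># D \<and> v z \<le> t. real (count D z)) =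
        (\<Sum>z\<in>insert 0 (set_mset D). real (count D z) * (if v z \<le> t then 1 else 0))"
      by (rule sum.mono_neutral_cong_left) (auto simp: not_in_iff)
    also have "\<dots> = real (count D 0) + (\<Sum>z\<in>?S. real (count D z) * (if v z \<le> t then 1 else 0))"
      using that by (subst sum.insert_remove) auto
    finally show ?thesis using pc[OF that(2)] pc0 by simp
  qed
  have "((\<lambda>t. \<Sum>z\<in>?S. real (count D z) * (if v z \<le> t then 1 / t else 0)) has_integral
      (\<Sum>z\<in>?S. real (count D z) * ln (max 1 (r / v z)))) {0..r}"
    using r by (intro has_integral_sum has_integral_mult_right has_integral_inverse_from) (auto simp: v_pos)
  then have "((\<lambda>t. (real (pole_count v t F) - real (pole_count v 0 F)) / t) has_integral
      (\<Sum>z\<in>?S. real (count D z) * ln (max 1 (r / v z)))) {0..r}"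
  proof (rule has_integral_eq[rotated])
    fix t assume t: "t \<in> {0..r}"
    have "real (count D z) * (if v z \<le> t then 1 / t else 0) =
        real (count D z) * (if v z \<le> t then 1 else 0) / t" for z by simp
    then show "(\<Sum>z\<in>?S. real (count D z) * (if v z \<le> t then 1 / t else 0)) =
        (real (pole_count v t F) - real (pole_count v 0 F)) / t"
      using t r by (subst split) (simp_all only: sum_divide_distrib, auto)
  qed
  then have "count_fn v r F = (\<Sum>z\<in>?S. real (count D z) * ln (max 1 (r / v z))) + real (count D 0) * ln r"
    unfolding count_fn_def by (simp add: integral_unique pc0)
  also have "\<dots> = (\<Sum>z\<in>?S. real (count D z) * ln (mu_entire v r (lin z))) + real (count D 0) * ln (mu_entire v r (lin 0))"
    using r by (simp add: mu_lin)
  also have "\<dots> = (\<Sum>z\<in>insert 0 (set_mset D). real (count D z) * ln (mu_entire v r (lin z)))"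
    by (subst sum.insert_remove) auto
  also have "\<dots> = (\<Sum>z\<in>set_mset D. real (count D z) * ln (mu_entire v r (lin z)))"
    by (rule sum.mono_neutral_right) (auto simp: not_in_iff)
  also have "\<dots> = ln (\<Prod>w\<in>#D. mu_entire v r (lin w))"
    unfolding image_prod_mset_multiplicity using mu_pos[OF entire_poly r(1) lin_neq_0]
    by (subst ln_prod) (simp_all add: ln_realpow less_imp_neq[THEN not_sym])
  finally show ?thesis .
qed

section \<open>Fractions reduced in a disc\<close>

lemma fls_subdegree_quotient:
  fixes G H :: "'a fps"
  assumes "G \<noteq> 0" "H \<noteq> 0"
  shows "fls_subdegree (fps_to_fls G / fps_to_fls H) = int (subdegree G) - int (subdegree H)"
  using assms by (subst fls_divide_subdegree) (auto simp: fls_subdegree_fls_to_fps)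

text \<open>A fraction with no common zeros in the disc; it depends on the disc, which avoids
  the Weierstrass products needed for a globally reduced fraction.\<close>

lemma reduced_fraction:
  assumes F: "F \<in> mero v" and R: "1 \<le> R"
  obtains G H where "entire v G" "entire v H" "H \<noteq> 0" "F = fps_to_fls G / fps_to_fls H"
    "fps_nth H (subdegree H) = 1" "subdegree H = nat (- fls_subdegree F)"
    "\<And>r. 0 < r \<Longrightarrow> r \<le> R \<Longrightarrow> count_fn v r F = ln (mu_entire v r H)"
proof (cases "F = 0")
  case True
  \<comment> \<open>The zero function has no finite multiset of zeros to cancel. Its subdegree is 0
    by convention, so it counts as having no poles.\<close>
  have "mero_comp v 1 z 0 = 0" for z using mero_comp_eq[of 0 1 1 z] by simp
  then have "pole_ord v F z = count {#} z" for z using True by (simp add: pole_ord_def)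
  then have "count_fn v r F = ln (\<Prod>w\<in>#{#}. mu_entire v r (lin w))" if "0 < r" "r \<le> R" for r
    using that by (intro count_fn_eq) auto
  then show ?thesis using True by (intro that[of 0 1]) auto
next
  case False
  obtain G0 H0 where GH: "entire v G0" "entire v H0" "H0 \<noteq> 0" "F = fps_to_fls G0 / fps_to_fls H0"
    using mero_cases[OF F] by blast
  have G0: "G0 \<noteq> 0" using GH False by auto
  obtain A U where A: "entire v U" "G0 = (\<Prod>w\<in>#A. lin w) * U" "\<forall>w\<in>#A. v w \<le> R"
      "\<forall>z. v z \<le> R \<longrightarrow> entire_eval v U z \<noteq> 0"
    using entire_factorization[OF GH(1) G0 R] by blast
  obtain B V where B: "entire v V" "H0 = (\<Prod>w\<in>#B. lin w) * V" "\<forall>w\<in>#B. v w \<le> R"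
      "\<forall>z. v z \<le> R \<longrightarrow> entire_eval v V z \<noteq> 0"
    using entire_factorization[OF GH(2,3) R] by blast
  have U0: "U \<noteq> 0" and V0: "V \<noteq> 0" using A(2) B(2) G0 GH(3) by auto
  \<comment> \<open>Multiset difference cancels common zeros with multiplicity: D keeps the poles of
    F in the disc, E its zeros.\<close>
  define D where "D = B - A"
  define E where "E = A - B"
  \<comment> \<open>Scales V to the value 1 at 0, so that the lowest coefficient of H becomes 1; G
    receives the same factor.\<close>
  define c where "c = inverse (fps_nth V 0)"
  define G where "G = (\<Prod>w\<in>#E. lin w) * (fps_const c * U)"
  define H where "H = (\<Prod>w\<in>#D. lin w) * (fps_const c * V)"
  have u: "fps_nth U 0 \<noteq> 0" and w: "fps_nth V 0 \<noteq> 0"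
    using A(1,4) B(1,4) R ev_at_0[of U] ev_at_0[of V] by force+
  have c: "c \<noteq> 0" using w by (simp add: c_def)
  have AE: "A = E + (A \<inter># B)" and BD: "B = D + (A \<inter># B)"
    by (auto simp: E_def D_def multiset_eq_iff)
  have EG: "entire v G" "entire v H" using A(1) B(1) by (auto simp: G_def H_def intro!: entire_mult)
  have H_0: "H \<noteq> 0" unfolding H_def using c V0 by simp
  have "(\<Prod>w\<in>#A. lin w) * (\<Prod>w\<in>#D. lin w) = (\<Prod>w\<in>#E. lin w) * (\<Prod>w\<in>#B. lin w)"
    using arg_cong[OF AE, of "\<lambda>M. \<Prod>w\<in>#M. lin w"] arg_cong[OF BD, of "\<lambda>M. \<Prod>w\<in>#M. lin w"]
    by (simp add: mult_ac)
  from arg_cong[OF this, of "\<lambda>x. x * (fps_const c * (U * V))"]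
  have "G0 * H = G * H0" unfolding A(2) B(2) G_def H_def by (simp add: mult_ac)
  then have FGH: "F = fps_to_fls G / fps_to_fls H" unfolding GH(4) using GH(3) H_0 by (subst fls_divide_eq_iff)
  have sub: "subdegree H = count D 0" "subdegree G0 = count A 0" "subdegree H0 = count B 0"
    using c V0 U0 u w by (auto simp: H_def A(2) B(2) subdegree_prod_lin subdegree_eq_0)
  have lead: "fps_nth H (subdegree H) = 1"
  proof -
    have "subdegree (fps_const c * V) = 0" using w c by (intro subdegree_eq_0) simp
    then show ?thesis unfolding H_def using c V0 w by (subst lead_mult) (auto simp: lead_prod_lin c_def)
  qed
  have "pole_ord v F z = count D z" if "v z \<le> R" for z
  proof -
    have "mero_comp v 1 z F = fps_to_fls (entire_comp v 1 z G0) / fps_to_fls (entire_comp v 1 z H0)"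
      using GH by (simp add: mero_comp_eq)
    then have "pole_ord v F z = nat (int (zord z H0) - int (zord z G0))"
      using GH G0 by (simp add: pole_ord_def zord_def fls_subdegree_quotient entire_comp_eq_0_iff)
    also have "zord z H0 = count B z" unfolding B(2) using B V0 that by (simp add: zord_mult zord_prod_lin zord_nonzero)
    also have "zord z G0 = count A z" unfolding A(2) using A U0 that by (simp add: zord_mult zord_prod_lin zord_nonzero)
    finally show ?thesis by (simp add: D_def)
  qed
  then have "count_fn v r F = ln (mu_entire v r H)" if r: "0 < r" "r \<le> R" for r
  proof -
    \<comment> \<open>Being zero-free in the disc, V contributes only |V(0)|, which c
      cancels.\<close>
    have "mu_entire v r V = v (fps_nth V 0)" using mu_zero_free[OF B(1) r] B(4) by blast
    then have "mu_entire v r H = (\<Prod>w\<in>#D. mu_entire v r (lin w))"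
      using r B(1) w by (simp add: H_def mu_mult mu_prod_mset entire_mult c_def)
    moreover have "v w \<le> R" if "w \<in># D" for w using that B(3) in_diffD unfolding D_def by metis
    ultimately show ?thesis using count_fn_eq[OF \<open>\<And>z. v z \<le> R \<Longrightarrow> pole_ord v F z = count D z\<close> _ r] by metis
  qed
  moreover have "subdegree H = nat (- fls_subdegree F)"
    unfolding GH(4) fls_subdegree_quotient[OF G0 GH(3)] sub by (simp add: D_def)
  ultimately show ?thesis using that[OF EG H_0 FGH lead] by blast
qed

subsection \<open>The characteristic function\<close>

lemma mu_ge_1:
  assumes "entire v H" "fps_nth H (subdegree H) = 1" "1 \<le> r"
  shows "1 \<le> mu_entire v r H"
  using order_trans[OF one_le_power[OF assms(3)] , of "subdegree H"] mu_ge[OF assms(1), of r "subdegree H"] assms(2,3)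
  by simp

lemma log_plus_nonneg: "0 \<le> log_plus x"
  and log_plus_ge_ln: "0 < x \<Longrightarrow> ln x \<le> log_plus x"
  by (auto simp: log_plus_def)

lemma count_fn_nonneg:
  assumes "F \<in> mero v" "1 \<le> r" shows "0 \<le> count_fn v r F"
proof -
  obtain G H where *: "entire v H" "fps_nth H (subdegree H) = 1"
    "\<And>t. 0 < t \<Longrightarrow> t \<le> r \<Longrightarrow> count_fn v t F = ln (mu_entire v t H)"
    using reduced_fraction[OF assms] by metis
  show ?thesis using *(3)[of r] mu_ge_1[OF *(1,2) assms(2)] assms by simp
qed

lemma prox_le_char: "F \<in> mero v \<Longrightarrow> 1 \<le> r \<Longrightarrow> prox v r F \<le> char_fn v r F"
  using count_fn_nonneg by (simp add: char_fn_def)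

lemma char_fn_nonneg: "F \<in> mero v \<Longrightarrow> 1 \<le> r \<Longrightarrow> 0 \<le> char_fn v r F"
  using count_fn_nonneg log_plus_nonneg by (simp add: char_fn_def prox_def)

lemma mu_mero_le_exp_char:
  assumes "F \<in> mero v" "1 \<le> r" shows "mu_mero v r F \<le> exp (char_fn v r F)"
proof (cases "mu_mero v r F = 0")
  case False
  then have pos: "0 < mu_mero v r F" using mu_mero_nonneg[OF assms(1), of r] assms(2) by simp
  then have "ln (mu_mero v r F) \<le> char_fn v r F"
    using log_plus_ge_ln[OF pos] prox_le_char[OF assms] by (simp add: prox_def)
  then show ?thesis using pos by (metis exp_le_cancel_iff exp_ln)
qed simp

text \<open>The norm of H is exp N(R, F), and that of G is at most exp m(R, F) times it, so T bounds
  both at the radius to which the fraction is adapted.\<close>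

lemma reduced_fraction_char:
  assumes F: "F \<in> mero v" and R: "1 \<le> R"
  obtains G H where "entire v G" "entire v H" "H \<noteq> 0" "F = fps_to_fls G / fps_to_fls H"
    "fps_nth H (subdegree H) = 1" "subdegree H = nat (- fls_subdegree F)"
    "mu_entire v R G \<le> exp (char_fn v R F)" "mu_entire v R H \<le> exp (char_fn v R F)"
proof -
  obtain G H where *: "entire v G" "entire v H" "H \<noteq> 0" "F = fps_to_fls G / fps_to_fls H"
    "fps_nth H (subdegree H) = 1" "subdegree H = nat (- fls_subdegree F)"
    "\<And>r. 0 < r \<Longrightarrow> r \<le> R \<Longrightarrow> count_fn v r F = ln (mu_entire v r H)"
    using reduced_fraction[OF assms] by blast
  have pos: "0 < mu_entire v R H" using mu_pos * R by simp
  then have H: "mu_entire v R H = exp (count_fn v R F)" using *(7)[of R] R by simp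
  also have "\<dots> \<le> exp (char_fn v R F)" using log_plus_nonneg by (simp add: char_fn_def prox_def)
  finally have 1: "mu_entire v R H \<le> exp (char_fn v R F)" .
  have "mu_entire v R G = mu_mero v R F * mu_entire v R H" using * R pos by (simp add: mu_mero_eq)
  also have "\<dots> \<le> exp (prox v R F) * exp (count_fn v R F)"
  proof -
    have "mu_mero v R F \<le> exp (prox v R F)"
      unfolding prox_def log_plus_def by (auto simp: not_le)
    then show ?thesis using H by simp
  qed
  also have "\<dots> = exp (char_fn v R F)" by (simp add: char_fn_def exp_add)
  finally show ?thesis using that[OF *(1-6)] 1 by blast
qed

text \<open>In fact exp T(R, F) grows at least linearly. With a pole at 0 the lowest coefficient of
  the denominator already shows this; otherwise a nonzero Taylor coefficient of positive index is
  compared with the coefficients of G and H.\<close>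

lemma char_fn_at_top:
  assumes F: "F \<in> mero v" and nc: "\<And>x. F \<noteq> fls_const x"
  shows "filterlim (\<lambda>r. char_fn v r F) at_top at_top"
proof -
  have "\<exists>c>0. \<forall>R\<ge>1. c * R \<le> exp (char_fn v R F)"
  proof (cases "fls_subdegree F < 0")
    case True
    have "1 * R \<le> exp (char_fn v R F)" if R: "1 \<le> R" for R
    proof -
      obtain G H where *: "entire v H" "fps_nth H (subdegree H) = 1" "subdegree H = nat (- fls_subdegree F)"
        "mu_entire v R H \<le> exp (char_fn v R F)"
        using reduced_fraction_char[OF F R] by metis
      have "R ^ 1 \<le> R ^ subdegree H" using True R unfolding *(3) by (intro power_increasing) auto
      also have "\<dots> \<le> mu_entire v R H" using mu_ge[OF *(1), of R "subdegree H"] *(2) R by simp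
      finally show ?thesis using *(4) by simp
    qed
    then show ?thesis by (intro exI[of _ 1]) auto
  next
    case False
    define P where "P = fls_regpart F"
    have FP: "F = fps_to_fls P" using False by (simp add: P_def)
    have "\<exists>n\<ge>1. fps_nth P n \<noteq> 0"
    proof (rule ccontr)
      assume "\<not> ?thesis"
      then have "P = fps_const (fps_nth P 0)" by (intro fps_ext) auto
      then show False using nc FP by (metis fps_const_to_fls)
    qed
    then obtain n where n: "1 \<le> n" "fps_nth P n \<noteq> 0" by blast
    \<comment> \<open>Dominates the lower Taylor coefficients; the summand 1 covers the term
      \<open>fps_nth G n\<close>.\<close>
    define K where "K = 1 + (\<Sum>i<n. v (fps_nth P i))"
    have K: "1 \<le> K" "v (fps_nth P i) \<le> K" if "i < n" for i
      using member_le_sum[of i "{..<n}" "\<lambda>i. v (fps_nth P i)"] that unfolding K_def by (auto simp: sum_nonneg)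
    have K1: "1 \<le> K" by (simp add: K_def sum_nonneg)
    have "v (fps_nth P n) / K * R \<le> exp (char_fn v R F)" if R: "1 \<le> R" for R
    proof -
      obtain G H where *: "entire v G" "entire v H" "H \<noteq> 0" "F = fps_to_fls G / fps_to_fls H"
        "fps_nth H (subdegree H) = 1" "subdegree H = nat (- fls_subdegree F)"
        "mu_entire v R G \<le> exp (char_fn v R F)" "mu_entire v R H \<le> exp (char_fn v R F)"
        using reduced_fraction_char[OF F R] by metis
      define E where "E = exp (char_fn v R F)"
      \<comment> \<open>Without a pole at 0 the lowest index of H is 0, so the relation P H = G can
        be solved for coefficient n of P.\<close>
      have H0: "fps_nth H 0 = 1" using * False by simp
      have "fps_to_fls (P * H) = fps_to_fls G" using * FP by (simp add: fls_times_fps_to_fls)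
      then have "P * H = G" by simp
      then have "fps_nth G n = (\<Sum>i=0..n. fps_nth P i * fps_nth H (n - i))" by (auto simp: fps_mult_nth)
      also have "\<dots> = (\<Sum>i<n. fps_nth P i * fps_nth H (n - i)) + fps_nth P n"
        using H0 by (simp add: atLeast0AtMost lessThan_Suc_atMost[symmetric])
      finally have Pn: "fps_nth P n = fps_nth G n - (\<Sum>i<n. fps_nth P i * fps_nth H (n - i))" by simp
      \<comment> \<open>A positive index gives R ^ k >= R, which is the source of the linear
        growth.\<close>
      have coeff: "v (fps_nth M k) \<le> E / R" if "entire v M" "mu_entire v R M \<le> E" "1 \<le> k" for M k
      proof -
        have "v (fps_nth M k) * R ^ 1 \<le> v (fps_nth M k) * R ^ k"
          using R that by (intro mult_left_mono power_increasing) auto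
        also have "\<dots> \<le> E" using mu_ge[OF that(1), of R k] R that(2) by linarith
        finally show ?thesis using R by (simp add: pos_le_divide_eq)
      qed
      have ER: "0 \<le> E / R" using R by (simp add: E_def)
      have "v (fps_nth P n) \<le> K * (E / R)"
        unfolding Pn
      proof (intro v_diff_le v_sum_le)
        have "v (fps_nth G n) \<le> 1 * (E / R)" using coeff[OF *(1) _ n(1)] *(7) by (simp add: E_def)
        also have "\<dots> \<le> K * (E / R)" using K1 ER by (intro mult_right_mono) auto
        finally show "v (fps_nth G n) \<le> K * (E / R)" .
        show "v (fps_nth P i * fps_nth H (n - i)) \<le> K * (E / R)" if "i \<in> {..<n}" for i
        proof -
          have "v (fps_nth H (n - i)) \<le> E / R" using that coeff[OF *(2), of "n - i"] *(8) by (auto simp: E_def)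
          then show ?thesis unfolding v_mult using K(2)[of i] K1 that by (intro mult_mono) auto
        qed
      qed (use K1 ER in \<open>auto intro!: mult_nonneg_nonneg simp del: times_divide_eq_right\<close>)
      then show ?thesis using K1 R by (simp add: E_def field_simps)
    qed
    moreover have "0 < v (fps_nth P n) / K" using n K1 by (simp add: v_pos)
    ultimately show ?thesis by blast
  qed
  then obtain c where c: "0 < c" "\<And>R. 1 \<le> R \<Longrightarrow> c * R \<le> exp (char_fn v R F)" by blast
  have "ln (c * R) \<le> char_fn v R F" if "1 \<le> R" for R
    using c that by (metis exp_gt_zero ln_exp ln_le_cancel_iff less_le_trans mult_pos_pos zero_less_one)
  then have "\<forall>\<^sub>F R in at_top. ln (c * R) \<le> char_fn v R F"
    unfolding eventually_at_top_linorder by blast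
  moreover have "filterlim (\<lambda>R. ln (c * R)) at_top at_top"
    using c by (intro filterlim_compose[OF ln_at_top] filterlim_tendsto_pos_mult_at_top[OF tendsto_const _ filterlim_ident])
  ultimately show ?thesis by (rule filterlim_at_top_mono[rotated])
qed

subsection \<open>Growth of denominators\<close>

text \<open>Comparing the denominator at two radii, rather than normalising a coefficient, makes the
  bound invariant under affine substitution.\<close>

definition den_growth :: "real \<Rightarrow> real \<Rightarrow> 'a fls \<Rightarrow> real \<Rightarrow> bool" where
  "den_growth s R F x \<longleftrightarrow> (\<exists>G H. entire v G \<and> entire v H \<and> H \<noteq> 0 \<and>
     F = fps_to_fls G / fps_to_fls H \<and> mu_entire v R H \<le> exp x * mu_entire v s H)"

lemma den_growth_mono:
  assumes "den_growth s R F x" "x \<le> y" "0 < s" shows "den_growth s R F y"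
proof -
  obtain G H where *: "entire v G" "entire v H" "H \<noteq> 0" "F = fps_to_fls G / fps_to_fls H"
    "mu_entire v R H \<le> exp x * mu_entire v s H" using assms(1) unfolding den_growth_def by blast
  have "exp x * mu_entire v s H \<le> exp y * mu_entire v s H"
    using assms mu_nonneg[OF *(2), of s] by (intro mult_right_mono) auto
  then show ?thesis unfolding den_growth_def using * order_trans by blast
qed

text \<open>The product of the denominators serves sum and product alike. Common factors may remain,
  since \<open>den_growth\<close> asks only for some fraction.\<close>

lemma den_growth_ring:
  assumes "den_growth s R F x" "den_growth s R F' y" and s: "0 < s" "0 < R"
  shows den_growth_add: "den_growth s R (F + F') (x + y)"
    and den_growth_mult: "den_growth s R (F * F') (x + y)"
proof -
  obtain G H where 1: "entire v G" "entire v H" "H \<noteq> 0" "F = fps_to_fls G / fps_to_fls H"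
    "mu_entire v R H \<le> exp x * mu_entire v s H" using assms(1) unfolding den_growth_def by blast
  obtain G' H' where 2: "entire v G'" "entire v H'" "H' \<noteq> 0" "F' = fps_to_fls G' / fps_to_fls H'"
    "mu_entire v R H' \<le> exp y * mu_entire v s H'" using assms(2) unfolding den_growth_def by blast
  have "mu_entire v R H * mu_entire v R H' \<le> (exp x * mu_entire v s H) * (exp y * mu_entire v s H')"
    using 1 2 mu_nonneg s by (intro mult_mono) auto
  then have le: "mu_entire v R (H * H') \<le> exp (x + y) * mu_entire v s (H * H')"
    using 1 2 s by (simp add: mu_mult exp_add mult_ac)
  have "F + F' = fps_to_fls (G * H' + G' * H) / fps_to_fls (H * H')"
    using 1 2 by (simp add: add_frac_eq fls_times_fps_to_fls)
  moreover have "F * F' = fps_to_fls (G * G') / fps_to_fls (H * H')"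
    using 1 2 by (simp add: fls_times_fps_to_fls)
  moreover have "entire v (G * H' + G' * H)" "entire v (G * G')" "entire v (H * H')" "H * H' \<noteq> 0"
    using 1 2 by (auto simp: entire_intros)
  ultimately show "den_growth s R (F + F') (x + y)" "den_growth s R (F * F') (x + y)"
    unfolding den_growth_def using le by blast+
qed

lemma den_growth_const: "0 < s \<Longrightarrow> 0 < R \<Longrightarrow> den_growth s R (fls_const c) 0"
  unfolding den_growth_def by (intro exI[of _ "fps_const c"] exI[of _ 1]) auto

lemma den_growth_uminus:
  assumes "den_growth s R F x" "0 < s" "0 < R" shows "den_growth s R (- F) x"
  using den_growth_mult[OF den_growth_const[of s R "-1"] assms(1)] assms(2,3) by simp

lemma den_growth_power:
  assumes "den_growth s R F x" "0 < s" "0 < R" shows "den_growth s R (F ^ n) (real n * x)"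
proof (induction n)
  case 0
  then show ?case using den_growth_const[of s R 1] assms by simp
next
  case (Suc n)
  then show ?case using den_growth_mult[OF assms(1) Suc.IH assms(2,3)] by (simp add: algebra_simps)
qed

lemma den_growth_prod:
  assumes "finite A" "\<And>k. k \<in> A \<Longrightarrow> den_growth s R (F k) (x k)" "0 < s" "0 < R"
  shows "den_growth s R (prod F A) (sum x A)"
  using assms
proof (induction A rule: finite_induct)
  case empty
  then show ?case using den_growth_const[of s R 1] by simp
qed (auto intro!: den_growth_mult)

lemma den_growth_sum:
  assumes "finite A" "\<And>k. k \<in> A \<Longrightarrow> den_growth s R (F k) (x k)" "0 < s" "0 < R"
  shows "den_growth s R (sum F A) (sum x A)"
  using assms
proof (induction A rule: finite_induct)
  case empty
  then show ?case using den_growth_const[of s R 0] by simp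
qed (auto intro!: den_growth_add)

lemma den_growth_comp:
  assumes "den_growth s R F x" and a: "v a = 1" "v b \<le> s" and s: "0 < s" "s \<le> R"
  shows "den_growth s R (mero_comp v a b F) x"
proof -
  obtain G H where *: "entire v G" "entire v H" "H \<noteq> 0" "F = fps_to_fls G / fps_to_fls H"
    "mu_entire v R H \<le> exp x * mu_entire v s H" using assms(1) unfolding den_growth_def by blast
  have a0: "a \<noteq> 0" using a by auto
  have "mu_entire v R (entire_comp v a b H) \<le> exp x * mu_entire v s (entire_comp v a b H)"
    using * a s by (simp add: mu_entire_comp)
  moreover have "mero_comp v a b F = fps_to_fls (entire_comp v a b G) / fps_to_fls (entire_comp v a b H)"
    using * a0 by (simp add: mero_comp_eq)
  moreover have "entire_comp v a b H \<noteq> 0" using * a0 by (simp add: entire_comp_eq_0_iff)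
  ultimately show ?thesis unfolding den_growth_def using * entire_entire_comp by blast
qed

text \<open>The normalised denominator has norm at most exp T at R and, having lowest coefficient 1,
  at least 1 at s >= 1.\<close>

lemma den_growth_char:
  assumes F: "F \<in> mero v" and s: "1 \<le> s" "s \<le> R"
  shows "den_growth s R F (char_fn v R F)"
proof -
  have R: "1 \<le> R" using s by simp
  obtain G H where *: "entire v G" "entire v H" "H \<noteq> 0" "F = fps_to_fls G / fps_to_fls H"
    "fps_nth H (subdegree H) = 1" "mu_entire v R H \<le> exp (char_fn v R F)"
    using reduced_fraction_char[OF F R] by metis
  have "exp (char_fn v R F) * 1 \<le> exp (char_fn v R F) * mu_entire v s H"
    using mu_ge_1[OF *(2,5) s(1)] by (intro mult_left_mono) auto
  then show ?thesis unfolding den_growth_def using * by (metis mult.right_neutral order_trans)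
qed

lemma den_growth_lower:
  assumes "den_growth s R F x" and s: "0 < s" "s \<le> R"
  shows "mu_mero v s F \<le> exp x * mu_mero v R F"
proof -
  obtain G H where *: "entire v G" "entire v H" "H \<noteq> 0" "F = fps_to_fls G / fps_to_fls H"
    "mu_entire v R H \<le> exp x * mu_entire v s H" using assms(1) unfolding den_growth_def by blast
  have R: "0 < R" using s by simp
  have p: "0 < mu_entire v s H" "0 < mu_entire v R H" using * mu_pos s R by auto
  have "mu_entire v s G * mu_entire v R H \<le> mu_entire v R G * (exp x * mu_entire v s H)"
    using mu_mono[OF *(1) s] *(5) mu_nonneg[OF *(1) R] p by (intro mult_mono) auto
  then show ?thesis unfolding *(4) using *(1-3) s R p by (simp add: mu_mero_eq field_simps)
qed

subsection \<open>Difference operators\<close>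

text \<open>The factor 2 in the growth bound comes from the two terms of a difference, whose
  denominators are multiplied; j iterations give 2 ^ j.\<close>

lemma mero_delta_props:
  assumes a: "v a = 1"
  shows mero_mero_delta: "F \<in> mero v \<Longrightarrow> mero_delta v a b F \<in> mero v"
    and mero_delta_add: "F \<in> mero v \<Longrightarrow> F' \<in> mero v \<Longrightarrow>
      mero_delta v a b (F + F') = mero_delta v a b F + mero_delta v a b F'"
    and mu_mero_delta_le: "F \<in> mero v \<Longrightarrow> 0 < r \<Longrightarrow> v b \<le> r \<Longrightarrow> mu_mero v r (mero_delta v a b F) \<le> mu_mero v r F"
    and den_growth_delta: "den_growth s R F x \<Longrightarrow> 0 < s \<Longrightarrow> v b \<le> s \<Longrightarrow> s \<le> R \<Longrightarrow>
      den_growth s R (mero_delta v a b F) (2 * x)"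
proof -
  have a0: "a \<noteq> 0" using a by auto
  show "F \<in> mero v \<Longrightarrow> mero_delta v a b F \<in> mero v"
    using a0 by (simp add: mero_delta_def mero_diff mero_mero_comp)
  show "F \<in> mero v \<Longrightarrow> F' \<in> mero v \<Longrightarrow> mero_delta v a b (F + F') = mero_delta v a b F + mero_delta v a b F'"
    using a0 by (simp add: mero_delta_def mero_comp_add)
  show "F \<in> mero v \<Longrightarrow> 0 < r \<Longrightarrow> v b \<le> r \<Longrightarrow> mu_mero v r (mero_delta v a b F) \<le> mu_mero v r F"
    using a a0 unfolding mero_delta_def by (intro mu_mero_diff_le) (auto simp: mero_mero_comp mu_mero_comp)
  show "den_growth s R F x \<Longrightarrow> 0 < s \<Longrightarrow> v b \<le> s \<Longrightarrow> s \<le> R \<Longrightarrow> den_growth s R (mero_delta v a b F) (2 * x)"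
    using den_growth_add[OF den_growth_comp den_growth_uminus, of s R F x a b F x] a
    by (simp add: mero_delta_def)
qed

lemma mero_delta_funpow_props:
  assumes a: "v a = 1"
  shows mero_delta_funpow: "F \<in> mero v \<Longrightarrow> (mero_delta v a b ^^ j) F \<in> mero v"
    and mero_delta_funpow_add: "F \<in> mero v \<Longrightarrow> F' \<in> mero v \<Longrightarrow>
      (mero_delta v a b ^^ j) (F + F') = (mero_delta v a b ^^ j) F + (mero_delta v a b ^^ j) F'"
    and mu_mero_delta_funpow_le: "F \<in> mero v \<Longrightarrow> 0 < r \<Longrightarrow> v b \<le> r \<Longrightarrow>
      mu_mero v r ((mero_delta v a b ^^ j) F) \<le> mu_mero v r F"
    and den_growth_delta_funpow: "den_growth s R F x \<Longrightarrow> 0 < s \<Longrightarrow> v b \<le> s \<Longrightarrow> s \<le> R \<Longrightarrow>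
      den_growth s R ((mero_delta v a b ^^ j) F) (2 ^ j * x)"
proof -
  show mem: "F \<in> mero v \<Longrightarrow> (mero_delta v a b ^^ j) F \<in> mero v" for F j
    by (induction j) (auto simp: mero_mero_delta[OF a])
  show "F \<in> mero v \<Longrightarrow> F' \<in> mero v \<Longrightarrow>
      (mero_delta v a b ^^ j) (F + F') = (mero_delta v a b ^^ j) F + (mero_delta v a b ^^ j) F'"
    by (induction j) (auto simp: mero_delta_add[OF a] mem)
  show "F \<in> mero v \<Longrightarrow> 0 < r \<Longrightarrow> v b \<le> r \<Longrightarrow> mu_mero v r ((mero_delta v a b ^^ j) F) \<le> mu_mero v r F"
    by (induction j) (auto intro: order_trans[OF mu_mero_delta_le[OF a mem]])
  show "den_growth s R F x \<Longrightarrow> 0 < s \<Longrightarrow> v b \<le> s \<Longrightarrow> s \<le> R \<Longrightarrow>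
      den_growth s R ((mero_delta v a b ^^ j) F) (2 ^ j * x)"
    by (induction j) (auto dest: den_growth_delta[OF a] simp: mult.assoc)
qed

section \<open>Perturbation of monomials\<close>

text \<open>Measuring each deviation as d times the bound of its factor makes the estimate stable
  under products with the same d.\<close>

lemma mu_mult_perturb:
  assumes "x \<in> mero v" "y \<in> mero v" "x' \<in> mero v" "y' \<in> mero v" and r: "0 < r"
    and "mu_mero v r x \<le> B" "mu_mero v r y' \<le> B'" "mu_mero v r (x - y) \<le> d * B" "mu_mero v r (x' - y') \<le> d * B'"
    and "0 \<le> B" "0 \<le> B'" "0 \<le> d"
  shows "mu_mero v r (x * x' - y * y') \<le> d * (B * B')"
proof -
  have "x * x' - y * y' = x * (x' - y') + (x - y) * y'" by (simp add: algebra_simps)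
  moreover have "mu_mero v r (x * (x' - y')) \<le> B * (d * B')"
    using assms by (subst mu_mero_mult) (auto simp: mero_diff mu_mero_nonneg intro!: mult_mono)
  moreover have "mu_mero v r ((x - y) * y') \<le> (d * B) * B'"
    using assms by (subst mu_mero_mult) (auto simp: mero_diff mu_mero_nonneg intro!: mult_mono)
  ultimately show ?thesis
    using assms by (auto simp: mult_ac intro!: mu_mero_add_le mero_mult mero_diff)
qed

lemma mu_power_le:
  assumes "x \<in> mero v" "0 < r" "mu_mero v r x \<le> B" shows "mu_mero v r (x ^ n) \<le> B ^ n"
proof (induction n)
  case (Suc n)
  have "0 \<le> mu_mero v r x" using assms mu_mero_nonneg by blast
  then show ?case using Suc assms mu_mero_nonneg[OF mero_power[OF assms(1)], of r n]
    by (auto simp: mu_mero_mult mero_power intro!: mult_mono)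
qed (use assms in simp)

lemma mu_power_perturb:
  assumes "x \<in> mero v" "y \<in> mero v" and r: "0 < r"
    and "mu_mero v r x \<le> B" "mu_mero v r y \<le> B" "mu_mero v r (x - y) \<le> d" and B: "1 \<le> B" and d: "0 \<le> d"
  shows "mu_mero v r (x ^ n - y ^ n) \<le> d * B ^ n"
proof (induction n)
  case 0
  then show ?case using r d by simp
next
  case (Suc n)
  \<comment> \<open>Since B >= 1, an absolute deviation d is also one relative to B, as
    \<open>mu_mult_perturb\<close> expects.\<close>
  have "d * 1 \<le> d * B" using B d by (intro mult_left_mono) auto
  then have "mu_mero v r (x - y) \<le> d * B" using assms by linarith
  then show ?case using Suc assms mu_power_le[of y r B n]
    by (simp add: mu_mult_perturb mero_power)
qed

text \<open>The first conjunct is carried through the induction because the splitting in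
  \<open>mu_mult_perturb\<close> needs a bound for the remaining product of the
  \<open>y k\<close>.\<close>

lemma mu_prod_perturb:
  assumes "finite A" and m: "\<And>k. k \<in> A \<Longrightarrow> x k \<in> mero v" "\<And>k. k \<in> A \<Longrightarrow> y k \<in> mero v" and r: "0 < r"
    and "\<And>k. k \<in> A \<Longrightarrow> mu_mero v r (x k) \<le> B" "\<And>k. k \<in> A \<Longrightarrow> mu_mero v r (y k) \<le> B"
    "\<And>k. k \<in> A \<Longrightarrow> mu_mero v r (x k - y k) \<le> d" and B: "1 \<le> B" and d: "0 \<le> d"
  shows "mu_mero v r (\<Prod>k\<in>A. y k ^ e k) \<le> B ^ (\<Sum>k\<in>A. e k) \<and>
    mu_mero v r ((\<Prod>k\<in>A. x k ^ e k) - (\<Prod>k\<in>A. y k ^ e k)) \<le> d * B ^ (\<Sum>k\<in>A. e k)"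
  using assms(1-3,5-7)
proof (induction A rule: finite_induct)
  case empty
  then show ?case using r d by simp
next
  case (insert k A)
  have mem: "(\<Prod>k\<in>A. x k ^ e k) \<in> mero v" "(\<Prod>k\<in>A. y k ^ e k) \<in> mero v"
    using insert.prems by (auto intro!: mero_prod mero_power)
  have IH: "mu_mero v r (\<Prod>k\<in>A. y k ^ e k) \<le> B ^ (\<Sum>k\<in>A. e k)"
    "mu_mero v r ((\<Prod>k\<in>A. x k ^ e k) - (\<Prod>k\<in>A. y k ^ e k)) \<le> d * B ^ (\<Sum>k\<in>A. e k)"
    using insert by auto
  have 1: "mu_mero v r (x k ^ e k) \<le> B ^ e k" "mu_mero v r (y k ^ e k) \<le> B ^ e k"
    "mu_mero v r (x k ^ e k - y k ^ e k) \<le> d * B ^ e k"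
    using insert.prems r B d by (auto intro!: mu_power_le mu_power_perturb)
  have xk: "x k ^ e k \<in> mero v" "y k ^ e k \<in> mero v" using insert.prems by (auto intro: mero_power)
  have "mu_mero v r (x k ^ e k * (\<Prod>k\<in>A. x k ^ e k) - y k ^ e k * (\<Prod>k\<in>A. y k ^ e k))
      \<le> d * (B ^ e k * B ^ (\<Sum>k\<in>A. e k))"
    using mu_mult_perturb[OF xk mem r 1(1) IH(1) 1(3) IH(2)] B d by simp
  moreover have "mu_mero v r (y k ^ e k * (\<Prod>k\<in>A. y k ^ e k)) \<le> B ^ e k * B ^ (\<Sum>k\<in>A. e k)"
    using 1 IH xk mem r B by (auto simp: mu_mero_mult mu_mero_nonneg intro!: mult_mono)
  ultimately show ?case using insert.hyps by (simp add: power_add)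
qed


subsection \<open>The theorem\<close>

lemma diff_tuple_props:
  assumes \<alpha>: "k \<noteq> 0 \<Longrightarrow> v (\<alpha> (idx k)) = 1" and \<beta>: "k \<noteq> 0 \<Longrightarrow> v (\<beta> (idx k)) \<le> s" and s: "0 < s" "s \<le> R"
  shows mero_diff_tuple: "F \<in> mero v \<Longrightarrow> diff_tuple v \<alpha> \<beta> idx jj F k \<in> mero v"
    and diff_tuple_add: "F \<in> mero v \<Longrightarrow> F' \<in> mero v \<Longrightarrow> diff_tuple v \<alpha> \<beta> idx jj (F + F') k =
      diff_tuple v \<alpha> \<beta> idx jj F k + diff_tuple v \<alpha> \<beta> idx jj F' k"
    and mu_diff_tuple_le: "F \<in> mero v \<Longrightarrow> mu_mero v R (diff_tuple v \<alpha> \<beta> idx jj F k) \<le> mu_mero v R F"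
    and den_growth_diff_tuple: "den_growth s R F x \<Longrightarrow> 0 \<le> x \<Longrightarrow>
      den_growth s R (diff_tuple v \<alpha> \<beta> idx jj F k) (2 ^ jj k * x)"
proof -
  have R: "0 < R" and \<beta>R: "k \<noteq> 0 \<Longrightarrow> v (\<beta> (idx k)) \<le> R" using s \<beta> by auto
  show "F \<in> mero v \<Longrightarrow> diff_tuple v \<alpha> \<beta> idx jj F k \<in> mero v"
    using \<alpha> by (auto simp: diff_tuple_def mero_delta_funpow)
  show "F \<in> mero v \<Longrightarrow> F' \<in> mero v \<Longrightarrow> diff_tuple v \<alpha> \<beta> idx jj (F + F') k =
      diff_tuple v \<alpha> \<beta> idx jj F k + diff_tuple v \<alpha> \<beta> idx jj F' k"
    using \<alpha> by (auto simp: diff_tuple_def mero_delta_funpow_add)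
  show "F \<in> mero v \<Longrightarrow> mu_mero v R (diff_tuple v \<alpha> \<beta> idx jj F k) \<le> mu_mero v R F"
    using \<alpha> \<beta>R R by (auto simp: diff_tuple_def mu_mero_delta_funpow_le)
  show "den_growth s R F x \<Longrightarrow> 0 \<le> x \<Longrightarrow> den_growth s R (diff_tuple v \<alpha> \<beta> idx jj F k) (2 ^ jj k * x)"
  proof (cases "k = 0")
    case True
    assume *: "den_growth s R F x" "0 \<le> x"
    \<comment> \<open>Entry 0 is F itself while \<open>jj 0\<close> is arbitrary, so x is relaxed to
      \<open>2 ^ jj 0 * x\<close>.\<close>
    have "1 * x \<le> 2 ^ jj k * x" using *(2) by (intro mult_right_mono) auto
    then show ?thesis using True den_growth_mono[OF *(1) _ s(1)] by (simp add: diff_tuple_def)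
  next
    case False
    assume "den_growth s R F x"
    then show ?thesis using False den_growth_delta_funpow[OF \<alpha>] \<beta> s by (simp add: diff_tuple_def)
  qed
qed

text \<open>The proximity is positive only where h has norm below 1; there the logarithm of the last
  hypothesis bounds minus the logarithm of that norm by x - ln p.\<close>

lemma prox_inverse_le:
  assumes h: "h \<in> mero v" and r: "0 < r" and p: "0 < p" and x: "0 \<le> x"
    and le: "mu_mero v r h \<le> 1 \<Longrightarrow> p \<le> mu_mero v r h * exp x"
  shows "prox v r (1 / h) \<le> x + \<bar>ln p\<bar>"
proof (cases "mu_mero v r (1 / h) \<le> 1")
  case True
  then show ?thesis using x by (simp add: prox_def log_plus_def)
next
  case False
  let ?m = "mu_mero v r h"
  have m: "1 < 1 / ?m" using False mu_mero_inverse[OF h r] by simp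
  then have m0: "0 < ?m" "?m \<le> 1" by (auto simp: less_divide_eq split: if_splits)
  have "ln p \<le> ln (?m * exp x)" using le[OF m0(2)] p m0 by simp
  then have "ln p \<le> ln ?m + x" using m0 by (simp add: ln_mult)
  moreover have "prox v r (1 / h) = - ln ?m"
    using m m0 mu_mero_inverse[OF h r] by (simp add: prox_def log_plus_def ln_div)
  ultimately show ?thesis by linarith
qed

text \<open>The right-hand side is free of T(r, f), so the smallness of a and of the coefficients
  relative to f can be left to the final step.\<close>

lemma prox_inverse_diff_le:
  fixes \<alpha> \<beta> :: "nat \<Rightarrow> 'a" and idx jj :: "nat \<Rightarrow> nat" and c :: "(nat \<Rightarrow> nat) \<Rightarrow> 'a fls"
  defines "D \<equiv> diff_tuple v \<alpha> \<beta> idx jj"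
  assumes \<alpha>: "\<forall>k\<in>{1..m}. v (\<alpha> (idx k)) = 1" and \<beta>: "\<forall>k\<in>{1..m}. v (\<beta> (idx k)) \<le> s"
    and fin: "finite I" and c: "\<forall>e\<in>I. c e \<in> mero v" and f: "f \<in> mero v" and a: "a \<in> mero v"
    and f0: "eval_mpoly m I c (D f) = 0" and a0: "eval_mpoly m I c (D a) \<noteq> 0"
    and s: "1 \<le> s"
  shows "\<exists>C K. \<forall>r\<ge>s. prox v r (1 / (f - a)) \<le> 2 * (\<Sum>e\<in>I. char_fn v r (c e)) + K * char_fn v r a + C"
proof -
  define P where "P = eval_mpoly m I c (D a)"
  define d where "d e = (\<Sum>k\<le>m. e k)" for e :: "nat \<Rightarrow> nat"
  \<comment> \<open>K1 weights the exponents by the doubling of denominators under differences; K2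
    dominates the total degree of every monomial.\<close>
  define K1 where "K1 = (\<Sum>e\<in>I. \<Sum>k\<le>m. real (e k) * 2 ^ jj k)"
  define K2 where "K2 = real (\<Sum>e\<in>I. d e)"
  define h where "h = f - a"
  have h: "h \<in> mero v" using f a by (simp add: h_def mero_diff)
  have fh: "f = a + h" by (simp add: h_def)
  have prem: "k \<noteq> 0 \<Longrightarrow> v (\<alpha> (idx k)) = 1" "k \<noteq> 0 \<Longrightarrow> v (\<beta> (idx k)) \<le> s" if "k \<le> m" for k
    using \<alpha> \<beta> that by auto
  have s0: "0 < s" using s by simp
  have Dm: "D g k \<in> mero v" if "g \<in> mero v" "k \<le> m" for g k
    unfolding D_def by (rule mero_diff_tuple[where s = s and R = s]) (use prem that s0 in auto)
  have prodm: "(\<Prod>k\<le>m. D g k ^ e k) \<in> mero v" if "g \<in> mero v" for g e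
    using Dm that by (intro mero_prod mero_power) auto
  have Pm: "P \<in> mero v" unfolding P_def eval_mpoly_def using prodm[OF a] c by (intro mero_sum mero_mult) auto
  have p0: "0 < mu_mero v s P" using Pm a0 s0 by (intro mu_mero_pos) (auto simp: P_def)
  have "prox v r (1 / (f - a)) \<le> 2 * (\<Sum>e\<in>I. char_fn v r (c e)) + (K1 + K2) * char_fn v r a + \<bar>ln (mu_mero v s P)\<bar>"
    if r: "s \<le> r" for r
  proof -
    have r1: "1 \<le> r" and r0: "0 < r" using r s by auto
    define S where "S = (\<Sum>e\<in>I. char_fn v r (c e))"
    define t where "t = char_fn v r a"
    have t: "0 \<le> t" unfolding t_def using char_fn_nonneg[OF a r1] .
    have ce: "0 \<le> char_fn v r (c e)" if "e \<in> I" for e using char_fn_nonneg[OF _ r1] c that by blast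
    have S: "0 \<le> S" unfolding S_def using ce by (rule sum_nonneg)
    have K: "0 \<le> K1" "0 \<le> K2" unfolding K1_def K2_def by (auto intro!: sum_nonneg)
    have "den_growth s r P (\<Sum>e\<in>I. char_fn v r (c e) + (\<Sum>k\<le>m. real (e k) * (2 ^ jj k * t)))"
      unfolding P_def eval_mpoly_def
    proof (intro den_growth_sum den_growth_mult den_growth_prod den_growth_power)
      fix e assume e: "e \<in> I"
      show "den_growth s r (c e) (char_fn v r (c e))" using c e s r by (intro den_growth_char) auto
      fix k assume k: "k \<in> {..m}"
      show "den_growth s r (D a k) (2 ^ jj k * t)" unfolding D_def t_def
        by (rule den_growth_diff_tuple) (use den_growth_char[OF a s r] t prem s0 r k in \<open>auto simp: t_def\<close>)
    qed (use fin s0 r0 in auto)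
    also have "(\<Sum>e\<in>I. char_fn v r (c e) + (\<Sum>k\<le>m. real (e k) * (2 ^ jj k * t))) = S + K1 * t"
      by (simp add: S_def K1_def sum.distrib sum_distrib_right mult.assoc)
    finally have low: "mu_mero v s P \<le> exp (S + K1 * t) * mu_mero v r P"
      using s0 r by (intro den_growth_lower)
    have up: "mu_mero v r P \<le> mu_mero v r h * exp (S + K2 * t)" if h1: "mu_mero v r h \<le> 1"
    proof -
      define B where "B = exp t"
      have B: "1 \<le> B" using t by (simp add: B_def)
      have aB: "mu_mero v r a \<le> B" unfolding B_def t_def using a r1 by (rule mu_mero_le_exp_char)
      \<comment> \<open>As f = a + h and h has norm at most 1, the bound for a also serves f,
        without recourse to T(r, f).\<close>
      have fB: "mu_mero v r f \<le> B" unfolding fh using a h r0 aB h1 B by (intro mu_mero_add_le) auto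
      have h0: "0 \<le> mu_mero v r h" using h r0 by (rule mu_mero_nonneg)
      have mu_D: "mu_mero v r (D g k) \<le> mu_mero v r g" if "g \<in> mero v" "k \<le> m" for g k
        unfolding D_def by (rule mu_diff_tuple_le[where s = s]) (use prem that s0 r in auto)
      have Dd: "D f k - D a k = D h k" if "k \<le> m" for k
      proof -
        have "D (a + h) k = D a k + D h k"
          unfolding D_def by (rule diff_tuple_add[where s = s and R = s]) (use prem that s0 a h in auto)
        then show ?thesis by (simp add: fh)
      qed
      have pert: "mu_mero v r ((\<Prod>k\<le>m. D f k ^ e k) - (\<Prod>k\<le>m. D a k ^ e k)) \<le> mu_mero v r h * B ^ d e" for e
        unfolding d_def
        by (rule conjunct2, rule mu_prod_perturb)
          (use Dm f a h r0 B h0 order_trans[OF mu_D[OF f] fB] order_trans[OF mu_D[OF a] aB] mu_D[OF h] Dd in auto)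
      have "P = - (\<Sum>e\<in>I. c e * ((\<Prod>k\<le>m. D f k ^ e k) - (\<Prod>k\<le>m. D a k ^ e k)))"
        using f0 by (simp add: P_def eval_mpoly_def right_diff_distrib sum_subtractf)
      also have "mu_mero v r \<dots> = mu_mero v r (\<Sum>e\<in>I. c e * ((\<Prod>k\<le>m. D f k ^ e k) - (\<Prod>k\<le>m. D a k ^ e k)))"
        using r0 c by (intro mu_mero_uminus mero_sum mero_mult mero_diff prodm f a) auto
      also have "\<dots> \<le> exp S * (mu_mero v r h * exp (K2 * t))"
      proof (rule mu_mero_sum_le)
        fix e assume e: "e \<in> I"
        then have cm: "c e \<in> mero v" using c by blast
        have qm: "(\<Prod>k\<le>m. D f k ^ e k) - (\<Prod>k\<le>m. D a k ^ e k) \<in> mero v"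
          using prodm f a by (intro mero_diff)
        show "c e * ((\<Prod>k\<le>m. D f k ^ e k) - (\<Prod>k\<le>m. D a k ^ e k)) \<in> mero v"
          using cm qm by (rule mero_mult)
        have "char_fn v r (c e) \<le> S" unfolding S_def using ce fin e by (intro member_le_sum) auto
        then have 1: "mu_mero v r (c e) \<le> exp S"
          using mu_mero_le_exp_char[OF cm r1] by (meson exp_le_cancel_iff order_trans)
        have "d e \<le> (\<Sum>e\<in>I. d e)" using fin e by (intro member_le_sum) auto
        then have "B ^ d e \<le> B ^ (\<Sum>e\<in>I. d e)" using B by (intro power_increasing)
        also have "\<dots> = exp (K2 * t)" unfolding B_def K2_def by (rule exp_of_nat_mult[symmetric])
        finally have 2: "mu_mero v r h * B ^ d e \<le> mu_mero v r h * exp (K2 * t)"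
          using h0 by (intro mult_left_mono)
        show "mu_mero v r (c e * ((\<Prod>k\<le>m. D f k ^ e k) - (\<Prod>k\<le>m. D a k ^ e k))) \<le> exp S * (mu_mero v r h * exp (K2 * t))"
          using 1 order_trans[OF pert 2] mu_mero_nonneg[OF qm r0] cm qm r0
          by (simp add: mu_mero_mult mult_mono)
      qed (use r0 h0 in auto)
      finally show ?thesis by (simp add: exp_add mult_ac)
    qed
    have "prox v r (1 / h) \<le> (2 * S + (K1 + K2) * t) + \<bar>ln (mu_mero v s P)\<bar>"
    proof (rule prox_inverse_le[OF h r0 p0])
      assume "mu_mero v r h \<le> 1"
      have "mu_mero v s P \<le> exp (S + K1 * t) * (mu_mero v r h * exp (S + K2 * t))"
        using order_trans[OF low mult_left_mono[OF up]] \<open>mu_mero v r h \<le> 1\<close> by simp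
      also have "\<dots> = mu_mero v r h * exp (2 * S + (K1 + K2) * t)"
        by (simp add: exp_add[symmetric] algebra_simps)
      finally show "mu_mero v s P \<le> mu_mero v r h * exp (2 * S + (K1 + K2) * t)" .
    qed (use S t K in auto)
    then show ?thesis by (simp add: h_def S_def t_def)
  qed
  then show ?thesis by blast
qed

end

lemma const_smallo_at_top:
  fixes T :: "real \<Rightarrow> real"
  assumes "filterlim T at_top at_top"
  shows "(\<lambda>_. C :: real) \<in> o[at_top](T)"
proof (rule landau_o.smallI)
  fix e :: real assume e: "0 < e"
  have "\<forall>\<^sub>F r in at_top. \<bar>C\<bar> / e \<le> T r" using assms by (simp add: filterlim_at_top)
  then show "\<forall>\<^sub>F r in at_top. norm C \<le> e * norm (T r)"
  proof eventually_elim
    case (elim r)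
    then have "\<bar>C\<bar> \<le> e * T r" using e by (simp add: pos_divide_le_eq mult.commute)
    also have "\<dots> \<le> e * \<bar>T r\<bar>" using e by (intro mult_left_mono) auto
    finally show ?case by simp
  qed
qed

theorem theorem6p3:
  fixes absv :: "'a::field_char_0 \<Rightarrow> real"
    and n m :: nat
    and \<alpha> \<beta> :: "nat \<Rightarrow> 'a"
    and idx jj :: "nat \<Rightarrow> nat"
    and I :: "(nat \<Rightarrow> nat) set"
    and c :: "(nat \<Rightarrow> nat) \<Rightarrow> 'a fls"
    and f a :: "'a fls"
  assumes "alg_closed TYPE('a)"
    and "nonarch_abs absv" and "nontrivial_abs absv" and "abs_complete absv"
    and "n \<ge> 1"
    and "\<forall>i\<in>{1..n}. absv (\<alpha> i) = 1"
    and "\<forall>i\<in>{1..n}. \<not> (\<alpha> i = 1 \<and> \<beta> i = 0)"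
    and "\<forall>k\<in>{1..m}. idx k \<in> {1..n} \<and> jj k \<ge> 1"
    and "finite I" and "I \<noteq> {}"
    and "\<forall>e\<in>I. \<forall>k>m. e k = 0"
    and "\<forall>e\<in>I. c e \<in> mero absv \<and> c e \<noteq> 0"
    and "f \<in> mero absv" and "\<forall>x. f \<noteq> fls_const x"
    and "eval_mpoly m I c (diff_tuple absv \<alpha> \<beta> idx jj f) = 0"
    and "(\<lambda>r. \<Sum>e\<in>I. char_fn absv r (c e)) \<in> o[at_top](\<lambda>r. char_fn absv r f)"
    and "a \<in> mero absv"
    and "(\<lambda>r. char_fn absv r a) \<in> o[at_top](\<lambda>r. char_fn absv r f)"
    and "eval_mpoly m I c (diff_tuple absv \<alpha> \<beta> idx jj a) \<noteq> 0"
  shows "(\<lambda>r. prox absv r (1 / (f - a))) \<in> o[at_top](\<lambda>r. char_fn absv r f)"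
proof -
  interpret nonarch_field absv using assms(1-4) by unfold_locales
  \<comment> \<open>At least 1, for the normalised denominators, and at least every |beta_i|, for
    the invariance of norms under substitution.\<close>
  define s where "s = 1 + (\<Sum>i\<in>{1..n}. absv (\<beta> i))"
  have "absv (\<beta> i) \<le> s" if "i \<in> {1..n}" for i
    using member_le_sum[of i "{1..n}" "\<lambda>i. absv (\<beta> i)"] that by (simp add: s_def)
  then have \<beta>: "\<forall>k\<in>{1..m}. absv (\<beta> (idx k)) \<le> s" using assms(8) by blast
  have s: "1 \<le> s" by (simp add: s_def sum_nonneg)
  have \<alpha>: "\<forall>k\<in>{1..m}. absv (\<alpha> (idx k)) = 1" using assms(6,8) by blast
  have c: "\<forall>e\<in>I. c e \<in> mero absv" using assms(12) by blast
  obtain C K where le: "\<And>r. s \<le> r \<Longrightarrow> prox absv r (1 / (f - a)) \<le>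
      2 * (\<Sum>e\<in>I. char_fn absv r (c e)) + K * char_fn absv r a + C"
    using prox_inverse_diff_le[OF \<alpha> \<beta> assms(9) c assms(13,17,15,19) s] by blast
  let ?B = "\<lambda>r. 2 * (\<Sum>e\<in>I. char_fn absv r (c e)) + K * char_fn absv r a + C"
  have "?B \<in> o[at_top](\<lambda>r. char_fn absv r f)"
    using assms(14,16,18)
    by (intro sum_in_smallo const_smallo_at_top char_fn_at_top[OF assms(13)])
      (auto intro: landau_o.small.cmult_in_iff')
  moreover have "(\<lambda>r. prox absv r (1 / (f - a))) \<in> O[at_top](?B)"
  proof (rule bigoI[where c = 1])
    show "\<forall>\<^sub>F r in at_top. norm (prox absv r (1 / (f - a))) \<le> 1 * norm (?B r)"
      unfolding eventually_at_top_linorder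
    proof (intro exI allI impI)
      fix r assume "s \<le> r"
      from le[OF this] show "norm (prox absv r (1 / (f - a))) \<le> 1 * norm (?B r)"
        using log_plus_nonneg[of "mu_mero absv r (1 / (f - a))"] by (simp add: prox_def)
    qed
  qed
  ultimately show ?thesis by (rule landau_o.big_small_trans[rotated])
qed

end
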